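(* Let $x\in(0,1]$ and let $\varphi\colon\mathbb{N}\to(0,1]$ be a positive function. For Lebesgue almost all $\beta>1$, the set $$\{y\in[0,1]\colon |T_\beta^n x-y|<\varphi(n)\text{ for infinitely many }n\in\mathbb{N}\}$$ has Lebesgue measure $0$ if $\sum_{n=1}^\infty\varphi(n)<\infty$, and Lebesgue measure $1$ if $\sum_{n=1}^\infty\varphi(n)=\infty$.
   Context: $\mathbb{N}=\{1,2,\dots\}$. For $\beta>1$, the beta-transformation $T_\beta\colon[0,1]\to[0,1]$ is $T_\beta(x)=\beta x-\lfloor\beta x\rfloor$ for all $x\in[0,1]$ (including $x=1$), where $\lfloor\cdot\rfloor$ is the integer part; $T_\beta^n$ is its $n$-th iterate. *)

theory Defs
  imports "HOL-Analysis.Analysis"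
begin

(* Total on the reals; for b > 1 it maps [0,1] into [0,1), so iterates started in [0,1] stay there.
   At x = 1 the value is b - floor b. *)
definition beta_transformation :: "real \<Rightarrow> real \<Rightarrow> real" where
  "beta_transformation b x = b * x - of_int \<lfloor>b * x\<rfloor>"

(* Indices n start at 1; the value phi 0 plays no role. *)
definition approximable_set :: "real \<Rightarrow> real \<Rightarrow> (nat \<Rightarrow> real) \<Rightarrow> real set" where
  "approximable_set b x \<phi> =
     {y \<in> {0..1}. infinite {n::nat. n \<ge> 1 \<and> \<bar>(beta_transformation b ^^ n) x - y\<bar> < \<phi> n}}"

end

theory Submission
  imports Defs
begin

text \<open>
  Fix \<open>x\<close> and write \<open>f\<^sub>n(\<beta>) = T\<^sub>\<beta>\<^sup>n x\<close>. If the radii are summable, the set of well approximated \<open>y\<close> is null for every single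
  \<open>\<beta>\<close> by the Borel--Cantelli lemma. The content is the divergent case, and there the idea is to let \<open>\<beta>\<close> and
  \<open>y\<close> be random at the same time: on a rectangle \<open>[a,b] \<times> [0,1]\<close> with \<open>1 < a\<close>, consider the events
  \<open>E\<^sub>n = {(\<beta>,y). \<bar>f\<^sub>n(\<beta>) - y\<bar> < \<phi>(n)}\<close>. It suffices that almost every \<open>(\<beta>,y)\<close> lies in infinitely many of
  them, because Fubini then gives, for almost every \<open>\<beta>\<close>, that almost every \<open>y\<close> is approximated infinitely
  often. Averaging over \<open>y\<close> turns the two estimates needed for a second moment argument into
  statements about the single functions \<open>f\<^sub>n\<close>:

  \<^item> An upper bound for overlaps. \<open>\<bar>E\<^sub>n \<inter> E\<^sub>m\<bar>\<close> is at most \<open>2 min(\<phi>(n),\<phi>(m))\<close> times the measure of those \<open>\<beta>\<close>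
    with \<open>\<bar>f\<^sub>m(\<beta>) - f\<^sub>n(\<beta>)\<bar> < \<phi>(n) + \<phi>(m)\<close>, and the latter is \<open>O(\<phi>(n) + \<phi>(m))\<close>
    (\<open>return_measure_le\<close>). Hence \<open>\<bar>E\<^sub>n \<inter> E\<^sub>m\<bar> = O(\<phi>(n) \<phi>(m))\<close>.

  \<^item> A lower bound in every box. For each interval \<open>[s,t] \<subseteq> [a,b]\<close> and all large \<open>n\<close>, the values of \<open>f\<^sub>n\<close> on
    \<open>[s,t]\<close> hit every interval \<open>(u,v)\<close> with measure at least \<open>c (t-s)(v-u)\<close>, where \<open>c\<close> does not depend on \<open>[s,t]\<close>
    (\<open>hitting_measure_ge\<close>). Hence \<open>\<bar>E\<^sub>n \<inter> K\<bar> \<ge> c' \<phi>(n) \<bar>K\<bar>\<close> for every box \<open>K\<close> and all large \<open>n\<close>.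

  The first bound makes the normalised counting functions \<open>(\<Sum>n\<le>N. 1\<^bsub>E\<^sub>n\<^esub>) / (\<Sum>n\<le>N. \<phi>(n))\<close> bounded in
  \<open>L\<^sup>2\<close>; the second one bounds every weak limit from below by \<open>c'\<close>, first on boxes and then, by approximation,
  on all measurable sets. On the set where only finitely many \<open>E\<^sub>n\<close> occur these functions tend to \<open>0\<close>, so that
  set is null (\<open>AE_infinite_of_second_moment\<close>).

  Both bounds come from the piecewise structure of \<open>f\<^sub>n\<close>. Between consecutive zeros \<open>f\<^sub>n\<close> is an increasing
  polynomial in \<open>\<beta>\<close> whose slope is comparable to \<open>\<beta>\<^sup>n\<close>, and at each zero it restarts from \<open>0\<close>.
  A piece may be much shorter than \<open>\<beta>\<^sup>-\<^sup>n\<close>, so counting pieces requires care.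
  Call a zero of \<open>f\<^sub>n\<close> fresh if it is not a zero of \<open>f\<^sub>n\<^sub>-\<^sub>1\<close>. The piece from one zero to a fresh zero is full: \<open>f\<^sub>n\<close>
  climbs from \<open>0\<close> all the way up to \<open>1\<close>, so the distance to the previous zero is at least of order \<open>\<beta>\<^sup>-\<^sup>n\<close>
  (\<open>fresh_zero_gap\<close>), while no piece is longer than order \<open>\<beta>\<^sup>-\<^sup>n\<close> (\<open>piece_length\<close>). Every zero of \<open>f\<^sub>n\<close> is fresh at
  exactly one stage \<open>j \<le> n\<close>, and the stages contribute a geometric series. The upper bound follows since
  \<open>f\<^sub>m - f\<^sub>n\<close> still has slope at least of order \<open>\<beta>\<^sup>m\<close> on the pieces of \<open>f\<^sub>m\<close>. For the lower bound, the pieces whose right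
  end became a zero long before stage \<open>n\<close> cover only a small proportion, so at least one of the last \<open>K\<close> stages has
  many full pieces; and each of these begins with an interval on which \<open>f\<^sub>n\<close> takes all values in \<open>[0,1)\<close>.
\<close>

section \<open>Difference quotients of orbits in the parameter\<close>

locale beta_orbit =
  fixes x :: real
  assumes x_pos: "0 < x" and x_le_1: "x \<le> 1"
begin

definition orb :: "nat \<Rightarrow> real \<Rightarrow> real" where
  "orb n b = (beta_transformation b ^^ n) x"

text \<open>
  The entry \<open>digit n b\<close> is the digit number \<open>n + 1\<close> of the expansion of \<open>x\<close> in base \<open>b\<close>.
\<close>
definition digit :: "nat \<Rightarrow> real \<Rightarrow> int" where
  "digit n b = \<lfloor>b * orb n b\<rfloor>"

text \<open>
  The parameter intervals on which an orbit function is one polynomial are the classes of this relation.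
\<close>
definition same_digits :: "nat \<Rightarrow> real \<Rightarrow> real \<Rightarrow> bool" where
  "same_digits n u v \<longleftrightarrow> (\<forall>k<n. digit k u = digit k v)"

lemma orb_0 [simp]: "orb 0 b = x"
  by (simp add: orb_def)

lemma orb_Suc: "orb (Suc n) b = b * orb n b - of_int (digit n b)"
  by (simp add: orb_def digit_def beta_transformation_def)

lemma orb_Suc_bounds: "0 \<le> orb (Suc n) b" "orb (Suc n) b < 1"
  unfolding orb_Suc digit_def by linarith+

lemma orb_bounds: "0 \<le> orb n b" "orb n b \<le> 1"
  using x_pos x_le_1 orb_Suc_bounds[of "n - 1" b] by (cases n; simp)+

lemma orb_Suc_eq_0: "orb n b = 0 \<Longrightarrow> orb (Suc n) b = 0"
  by (simp add: orb_Suc digit_def)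

lemma orb_eq_0_mono: "i \<le> n \<Longrightarrow> orb i b = 0 \<Longrightarrow> orb n b = 0"
  by (induction rule: dec_induct) (auto intro: orb_Suc_eq_0)

lemma same_digits_sym: "same_digits n u v \<Longrightarrow> same_digits n v u"
  by (auto simp: same_digits_def)

lemma same_digits_trans: "same_digits n u v \<Longrightarrow> same_digits n v w \<Longrightarrow> same_digits n u w"
  by (auto simp: same_digits_def)

lemma same_digits_mono: "same_digits n u v \<Longrightarrow> k \<le> n \<Longrightarrow> same_digits k u v"
  by (auto simp: same_digits_def)

lemma same_digits_0 [simp]: "same_digits 0 u v"
  by (auto simp: same_digits_def)

lemma same_digits_Suc:
  "same_digits (Suc n) u v \<longleftrightarrow> same_digits n u v \<and> digit n u = digit n v"
  by (auto simp: same_digits_def less_Suc_eq)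

text \<open>
  For two parameters with equal digits the floors cancel, so differences of orbits satisfy an exact
  linear recursion. It replaces derivatives throughout: it gives two-sided bounds for difference quotients without
  any appeal to smoothness. By the symmetry of \<open>u\<close> and \<open>v\<close> it may be used with either of them as the factor of the
  previous difference.
\<close>
lemma orb_diff_Suc:
  assumes "digit n u = digit n v"
  shows "orb (Suc n) v - orb (Suc n) u = (v - u) * orb n v + u * (orb n v - orb n u)"
  using assms by (simp add: orb_Suc algebra_simps)

lemma orb_diff_mono:
  assumes "same_digits n u v" "0 \<le> u" "u \<le> v"
  shows "orb n u \<le> orb n v"
  using assms
proof (induction n)
  case (Suc n)
  then have "same_digits n u v" "digit n u = digit n v" by (auto simp: same_digits_Suc)
  moreover have "0 \<le> (v - u) * orb n v" using Suc.prems orb_bounds by simp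
  ultimately show ?case
    using orb_diff_Suc[of n u v] Suc by (smt (verit) mult_nonneg_nonneg)
qed simp

lemma orb_diff_upper:
  assumes "same_digits n u v" "0 \<le> u" "u \<le> v"
  shows "orb n v - orb n u \<le> (v - u) * (\<Sum>k<n. u ^ k)"
  using assms
proof (induction n)
  case (Suc n)
  then have *: "same_digits n u v" "digit n u = digit n v" by (auto simp: same_digits_Suc)
  have "(v - u) * orb n v \<le> (v - u) * 1"
    using Suc.prems orb_bounds by (intro mult_left_mono) auto
  moreover have "u * (orb n v - orb n u) \<le> u * ((v - u) * (\<Sum>k<n. u ^ k))"
    using Suc * by (intro mult_left_mono) auto
  moreover have "(\<Sum>k<Suc n. u ^ k) = 1 + u * (\<Sum>k<n. u ^ k)"
    by (simp add: sum.lessThan_Suc_shift sum_distrib_left del: sum.lessThan_Suc)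
  ultimately show ?case
    using orb_diff_Suc[OF *(2)] by (simp add: algebra_simps)
qed simp

lemma geometric_sum_le:
  assumes "1 < (u::real)"
  shows "(\<Sum>k<n. u ^ k) \<le> u ^ n / (u - 1)"
  using assms by (simp add: geometric_sum divide_right_mono)

lemma orb_diff_step:
  assumes "same_digits (Suc n) u v" "0 \<le> u" "u \<le> v"
  shows "v * (orb n v - orb n u) \<le> orb (Suc n) v - orb (Suc n) u"
proof -
  have "digit n v = digit n u" using assms by (auto simp: same_digits_Suc)
  moreover have "0 \<le> (v - u) * orb n u" using assms orb_bounds by simp
  ultimately show ?thesis
    using orb_diff_Suc[of n v u] by (simp add: algebra_simps)
qed

text \<open>
  Up to the constant \<open>x\<close>, the slope is at least the power \<open>v ^ n\<close> of the right end. Using the larger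
  of the two parameters allows the length of a piece to be expressed through its right end, the zero to which the piece
  is charged in \<open>interval_length_le_sum\<close>.
\<close>
lemma orb_diff_lower:
  assumes "same_digits (Suc n) u v" "0 \<le> u" "u \<le> v"
  shows "(v - u) * x * v ^ n \<le> orb (Suc n) v - orb (Suc n) u"
  using assms
proof (induction n)
  case 0
  then show ?case by (simp add: orb_Suc same_digits_Suc algebra_simps)
next
  case (Suc n)
  have "same_digits (Suc n) u v" using Suc.prems by (auto simp: same_digits_Suc)
  then have "v * ((v - u) * x * v ^ n) \<le> v * (orb (Suc n) v - orb (Suc n) u)"
    using Suc by (intro mult_left_mono) auto
  also have "\<dots> \<le> orb (Suc (Suc n)) v - orb (Suc (Suc n)) u"
    by (rule orb_diff_step) (use Suc in auto)
  finally show ?case by (simp add: algebra_simps)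
qed

lemma orb_strict_mono:
  assumes "same_digits n u v" "0 \<le> u" "u < v" "0 < n"
  shows "orb n u < orb n v"
proof -
  obtain k where k: "n = Suc k" using assms gr0_conv_Suc by auto
  have "0 < (v - u) * x * v ^ k" using assms x_pos by simp
  then show ?thesis using orb_diff_lower[of k u v] assms k by auto
qed

text \<open>
  Each step multiplies a difference by at least \<open>v > 1\<close>, so the earlier difference is at most the fraction
  \<open>1 / v\<close> of the later one and cannot cancel it. This keeps the return function \<open>orb m - orb n\<close> as steep as
  \<open>orb m\<close> itself, even for \<open>m = n + 1\<close>.
\<close>
lemma orb_diff_diff_lower:
  assumes "same_digits (Suc m) u v" "1 \<le> u" "u \<le> v" "n \<le> m"
  shows "(1 - 1 / v) * ((v - u) * x * v ^ m) \<le>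
           (orb (Suc m) v - orb (Suc m) u) - (orb n v - orb n u)"
proof -
  have mono: "orb i v - orb i u \<le> orb m v - orb m u" if "i \<le> m" for i
    using that
  proof (induction i rule: inc_induct)
    case (step i)
    have s: "same_digits (Suc i) u v" using step assms same_digits_mono by (meson Suc_leI le_SucI)
    have nn: "0 \<le> orb i v - orb i u"
      using orb_diff_mono[of i u v] s assms by (auto simp: same_digits_Suc)
    have "orb i v - orb i u \<le> v * (orb i v - orb i u)"
      using mult_right_mono[of 1 v, OF _ nn] assms by simp
    also have "\<dots> \<le> orb (Suc i) v - orb (Suc i) u"
      by (rule orb_diff_step) (use s assms in auto)
    finally show ?case using step by linarith
  qed simp
  let ?d = "orb (Suc m) v - orb (Suc m) u"
  have "v * (orb m v - orb m u) \<le> ?d"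
    by (rule orb_diff_step) (use assms in auto)
  then have "orb m v - orb m u \<le> ?d / v"
    using assms by (simp add: field_simps)
  with mono[OF assms(4)] have "?d - ?d / v \<le> ?d - (orb n v - orb n u)"
    by linarith
  then have "?d * (1 - 1 / v) \<le> ?d - (orb n v - orb n u)"
    by (simp add: right_diff_distrib)
  moreover have "(1 - 1 / v) * ((v - u) * x * v ^ m) \<le> (1 - 1 / v) * ?d"
    using assms by (intro mult_left_mono orb_diff_lower) (auto simp: field_simps)
  ultimately show ?thesis by (simp add: mult.commute)
qed

section \<open>Monotone pieces and zeros of the orbit functions\<close>
text \<open>
  Between \<open>u\<close> and \<open>v\<close> the value \<open>w * orb n w\<close> lies between two numbers with the same floor.
\<close>
lemma same_digits_convex:
  assumes "same_digits n u v" "0 \<le> u" "u \<le> w" "w \<le> v"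
  shows "same_digits n u w"
  using assms
proof (induction n)
  case (Suc n)
  then have uv: "same_digits n u v" "digit n u = digit n v" by (auto simp: same_digits_Suc)
  with Suc have uw: "same_digits n u w" by auto
  then have wv: "same_digits n w v" using uv same_digits_sym same_digits_trans by blast
  have "u * orb n u \<le> w * orb n w"
    using orb_diff_mono[OF uw] Suc.prems orb_bounds by (intro mult_mono) auto
  moreover have "w * orb n w \<le> v * orb n v"
    using orb_diff_mono[OF wv] Suc.prems orb_bounds by (intro mult_mono) auto
  ultimately have "digit n u = digit n w"
    using uv(2) unfolding digit_def by (metis floor_mono order_antisym)
  with uw show ?case by (simp add: same_digits_Suc)
qed simp

lemma continuous_on_orb:
  assumes "same_digits n u v" "0 \<le> u"
  shows "continuous_on {u..v} (orb n)"
  using assms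
proof (induction n)
  case (Suc n)
  then have "continuous_on {u..v} (orb n)" by (auto simp: same_digits_Suc)
  then have "continuous_on {u..v} (\<lambda>w. w * orb n w - of_int (digit n u))"
    by (intro continuous_intros)
  moreover have "w * orb n w - of_int (digit n u) = orb (Suc n) w" if "w \<in> {u..v}" for w
    using same_digits_convex[OF Suc.prems, of w] that by (auto simp: orb_Suc same_digits_Suc)
  ultimately show ?case by (rule continuous_on_eq)
next
  case 0
  then show ?case by (simp add: orb_def)
qed

text \<open>
  A change of digit forces, by the intermediate value theorem, a parameter at which \<open>w * orb n w\<close> is an
  integer, and there the next orbit point vanishes. So pieces are separated exactly by zeros.
\<close>
lemma same_digits_if_no_zero:
  assumes "0 \<le> u" "u \<le> v" "\<And>w. u < w \<Longrightarrow> w \<le> v \<Longrightarrow> orb n w \<noteq> 0"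
  shows "same_digits n u v"
  using assms
proof (induction n)
  case (Suc n)
  then have sd: "same_digits n u v" using orb_Suc_eq_0 by blast
  have "u * orb n u \<le> v * orb n v"
    using orb_diff_mono[OF sd] Suc.prems orb_bounds by (intro mult_mono) auto
  then have le: "digit n u \<le> digit n v" by (simp add: digit_def floor_mono)
  have "\<not> digit n u < digit n v"
  proof
    assume less: "digit n u < digit n v"
    then have lt: "u * orb n u < of_int (digit n v)" unfolding digit_def by linarith
    have "continuous_on {u..v} (\<lambda>w. w * orb n w)"
      using continuous_on_orb[OF sd] Suc.prems by (intro continuous_intros) auto
    then obtain w where w: "u \<le> w" "w \<le> v" "w * orb n w = of_int (digit n v)"
      using IVT'[of "\<lambda>w. w * orb n w" u "of_int (digit n v)" v] lt Suc.prems
      by (auto simp: digit_def)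
    have "orb (Suc n) w = 0" unfolding orb_Suc digit_def w(3) by simp
    moreover have "u < w" using w lt by (cases "u = w") auto
    ultimately show False using Suc.prems w by blast
  qed
  with le sd show ?case by (simp add: same_digits_Suc)
qed simp

definition zeros :: "nat \<Rightarrow> real \<Rightarrow> real \<Rightarrow> real set" where
  "zeros n s t = {w \<in> {s<..t}. orb n w = 0}"

text \<open>
  The index is shifted: \<open>fresh_zeros n\<close> collects the zeros of \<open>orb (Suc n)\<close> that are new at that stage.
\<close>
definition fresh_zeros :: "nat \<Rightarrow> real \<Rightarrow> real \<Rightarrow> real set" where
  "fresh_zeros n s t = {w \<in> {s<..t}. orb (Suc n) w = 0 \<and> orb n w \<noteq> 0}"

text \<open>
  A zero is determined by its digits, because the orbit function is strictly increasing on each class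
  of parameters with common digits; and there are only finitely many digit strings.
\<close>
lemma finite_zeros:
  assumes "0 \<le> s"
  shows "finite (zeros n s t)"
proof (cases "n = 0")
  case True
  then show ?thesis using x_pos by (simp add: zeros_def)
next
  case False
  let ?ds = "\<lambda>w. map (\<lambda>k. digit k w) [0..<n]"
  have "inj_on ?ds (zeros n s t)"
  proof (rule linorder_inj_onI)
    fix u v assume uv: "u < v" "u \<in> zeros n s t" "v \<in> zeros n s t"
    show "?ds u \<noteq> ?ds v"
    proof
      assume "?ds u = ?ds v"
      then have "same_digits n u v" by (simp add: same_digits_def)
      then show False
        using orb_strict_mono[of n u v] uv False assms by (auto simp: zeros_def)
    qed
  qed auto
  moreover have "?ds ` zeros n s t \<subseteq> {xs. set xs \<subseteq> {0..\<lfloor>t\<rfloor>} \<and> length xs = n}"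
  proof clarsimp
    fix w k assume w: "w \<in> zeros n s t"
    then have "w * orb k w \<le> t * 1"
      using assms orb_bounds by (intro mult_mono) (auto simp: zeros_def)
    moreover have "0 \<le> w * orb k w"
      using w assms orb_bounds by (simp add: zeros_def)
    ultimately show "0 \<le> digit k w \<and> digit k w \<le> \<lfloor>t\<rfloor>" by (simp add: digit_def floor_mono)
  qed
  moreover have "finite {xs. set xs \<subseteq> {0..\<lfloor>t\<rfloor>} \<and> length xs = n}"
    by (rule finite_lists_length_eq) simp
  ultimately show ?thesis using finite_imageD finite_subset by blast
qed

lemma fresh_zeros_subset: "fresh_zeros n s t \<subseteq> zeros (Suc n) s t"
  by (auto simp: zeros_def fresh_zeros_def)

lemma finite_fresh_zeros: "0 \<le> s \<Longrightarrow> finite (fresh_zeros n s t)"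
  using finite_subset[OF fresh_zeros_subset finite_zeros] .

lemma zeros_eq_Union_fresh: "zeros n s t = (\<Union>j<n. fresh_zeros j s t)"
proof (induction n)
  case 0
  then show ?case using x_pos by (auto simp: zeros_def)
next
  case (Suc n)
  have "zeros (Suc n) s t = zeros n s t \<union> fresh_zeros n s t"
    using orb_Suc_eq_0 by (auto simp: zeros_def fresh_zeros_def)
  then show ?case using Suc by (auto simp: lessThan_Suc)
qed

lemma fresh_zeros_disjoint: "i \<noteq> j \<Longrightarrow> fresh_zeros i s t \<inter> fresh_zeros j s t = {}"
proof (induction i j rule: linorder_wlog)
  case (le i j)
  have "orb j w = 0" if "orb (Suc i) w = 0" for w
    using orb_eq_0_mono[of "Suc i" j w] that le by simp
  then show ?case by (auto simp: fresh_zeros_def)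
qed auto

lemma sum_zeros:
  fixes w :: "real \<Rightarrow> real"
  assumes "0 \<le> s"
  shows "(\<Sum>v\<in>zeros n s t. w v) = (\<Sum>j<n. \<Sum>v\<in>fresh_zeros j s t. w v)"
  unfolding zeros_eq_Union_fresh
  by (rule sum.UNION_disjoint) (auto simp: finite_fresh_zeros assms fresh_zeros_disjoint)

lemma last_zero:
  assumes "0 \<le> s" "s < v" "orb n v \<noteq> 0"
  obtains q where "s \<le> q" "q < v" "same_digits n q v" "q = s \<or> orb n q = 0"
proof -
  let ?Z = "insert s (zeros n s v)"
  have fin: "finite ?Z" using assms finite_zeros by simp
  define q where "q = Max ?Z"
  have q: "q \<in> ?Z" using Max_in[OF fin] by (auto simp: q_def)
  have "same_digits n q v"
  proof (rule same_digits_if_no_zero)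
    fix w assume "q < w" "w \<le> v"
    then show "orb n w \<noteq> 0"
      using Max_ge[OF fin, of w] q assms unfolding q_def[symmetric] by (auto simp: zeros_def)
  qed (use q assms in \<open>auto simp: zeros_def\<close>)
  moreover have "q < v" using q assms unfolding zeros_def by (cases "q = v") auto
  ultimately show ?thesis using q by (intro that[of q]) (auto simp: zeros_def)
qed

text \<open>
  On the piece that ends at a fresh zero \<open>v\<close>, the quantity \<open>\<beta> * orb n \<beta>\<close> increases from one integer to a larger
  one. It grows by at least \<open>1\<close> with slope of order at most \<open>v ^ Suc n\<close>, so the piece cannot be short. At a zero
  which is not fresh this fails: the orbit function may be cut off early there.
\<close>
lemma fresh_zero_gap:
  assumes "1 < u" "u < v" "orb (Suc n) u = 0" "v \<in> fresh_zeros n s t"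
  shows "(u - 1) / v ^ Suc n \<le> v - u"
proof -
  have v: "orb (Suc n) v = 0" "orb n v \<noteq> 0" using assms by (auto simp: fresh_zeros_def)
  \<comment> \<open>The left end of the piece at whose right end v sits.\<close>
  obtain q where q: "u \<le> q" "q < v" "same_digits n q v" "q = u \<or> orb n q = 0"
    using last_zero[of u v n] assms v by auto
  have q0: "orb (Suc n) q = 0" using q assms orb_Suc_eq_0 by auto
  have "q * orb n q < v * orb n v"
  proof -
    have "0 < orb n v" using v orb_bounds[of n v] by linarith
    then have "q * orb n v < v * orb n v" using q by simp
    moreover have "q * orb n q \<le> q * orb n v"
      using orb_diff_mono[OF q(3)] q assms by (intro mult_left_mono) auto
    ultimately show ?thesis by linarith
  qed
  moreover have "q * orb n q = of_int (digit n q)" "v * orb n v = of_int (digit n v)"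
    using q0 v by (auto simp: orb_Suc)
  ultimately have "digit n q + 1 \<le> digit n v"
    "v * orb n v - q * orb n q = of_int (digit n v - digit n q)" by simp_all
  then have "1 \<le> v * orb n v - q * orb n q" by linarith
  also have "\<dots> = (v - q) * orb n v + q * (orb n v - orb n q)" by (simp add: algebra_simps)
  also have "\<dots> \<le> (v - q) * 1 + q * ((v - q) * (\<Sum>k<n. q ^ k))"
    using orb_diff_upper[OF q(3)] q assms orb_bounds by (intro add_mono mult_left_mono) auto
  also have "\<dots> = (v - q) * (\<Sum>k<Suc n. q ^ k)"
    by (simp add: sum.lessThan_Suc_shift sum_distrib_left algebra_simps del: sum.lessThan_Suc)
  also have "\<dots> \<le> (v - q) * (q ^ Suc n / (q - 1))"
    using q assms by (intro mult_left_mono geometric_sum_le) auto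
  also have "\<dots> \<le> (v - u) * (v ^ Suc n / (u - 1))"
    using q assms by (intro mult_mono frac_le power_mono) auto
  finally show ?thesis using assms by (simp add: field_simps)
qed

end

section \<open>Weighted counting of zeros\<close>
text \<open>
  The gaps between consecutive elements add up to the spread. The least element has no gap to its left, which is
  why it is left out.
\<close>
lemma sum_le_spread:
  fixes w :: "real \<Rightarrow> real"
  assumes "finite D" "D \<noteq> {}" "\<And>u v. u \<in> D \<Longrightarrow> v \<in> D \<Longrightarrow> u < v \<Longrightarrow> w v \<le> v - u"
  shows "(\<Sum>v\<in>D - {Min D}. w v) \<le> Max D - Min D"
  using assms
proof (induction D rule: finite_linorder_max_induct)
  case (insert b A)
  show ?case
  proof (cases "A = {}")
    case False
    have less: "Min A < b" "Max A < b" "b \<notin> A" using insert False by auto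
    then have Min: "Min (insert b A) = Min A" and Max: "Max (insert b A) = b"
      using insert(1) False less by (simp_all add: Min.insert Max.insert)
    have "(\<Sum>v\<in>insert b A - {Min A}. w v) = w b + (\<Sum>v\<in>A - {Min A}. w v)"
      using less insert(1) by (simp add: insert_Diff_if)
    moreover have "w b \<le> b - Max A"
      by (rule insert.prems) (use insert(1) False less in auto)
    moreover have "(\<Sum>v\<in>A - {Min A}. w v) \<le> Max A - Min A"
      using insert False by auto
    ultimately show ?thesis unfolding Min Max by simp
  qed simp
qed simp

lemma spread_le_sum:
  fixes w :: "real \<Rightarrow> real"
  assumes "finite B" "B \<subseteq> {s<..}" "B \<noteq> {}"
    "\<And>u r. r \<in> B \<Longrightarrow> s \<le> u \<Longrightarrow> u < r \<Longrightarrow> B \<inter> {u<..<r} = {} \<Longrightarrow> r - u \<le> w r"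
  shows "Max B - s \<le> (\<Sum>r\<in>B. w r)"
  using assms
proof (induction B rule: finite_linorder_max_induct)
  case (insert b A)
  show ?case
  proof (cases "A = {}")
    case True
    then show ?thesis using insert.prems(3)[of b s] insert.prems(1) by auto
  next
    case False
    have M: "Max A \<in> A" using insert(1) False by simp
    then have less: "Max A < b" "b \<notin> A" using insert(2) by auto
    have s: "s \<le> Max A" using M insert.prems(1) by auto
    have Max: "Max (insert b A) = b" using insert(1) False less by (simp add: Max.insert)
    have "b - Max A \<le> w b"
      by (rule insert.prems(3)) (use less s in \<open>auto dest: Max_ge[OF insert(1)]\<close>)
    moreover have "Max A - s \<le> (\<Sum>r\<in>A. w r)"
    proof (rule insert.IH)
      fix u r assume *: "r \<in> A" "s \<le> u" "u < r" "A \<inter> {u<..<r} = {}"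
      then have "insert b A \<inter> {u<..<r} = {}" using insert(2) by force
      then show "r - u \<le> w r" using * by (intro insert.prems(3)) auto
    qed (use insert False in auto)
    ultimately show ?thesis unfolding Max using insert(1) less by simp
  qed
qed simp

lemma fmeasurable_Icc: "{c..d::real} \<in> fmeasurable lborel"
  by (simp add: fmeasurable_def emeasure_lborel_Icc_eq)

context beta_orbit
begin

lemma measurable_orb [measurable]: "orb n \<in> borel_measurable borel"
proof (induction n)
  case 0
  then show ?case by (simp add: orb_def)
next
  case (Suc n)
  then have [measurable]: "orb n \<in> borel_measurable borel" .
  have "orb (Suc n) = (\<lambda>b. b * orb n b - real_of_int \<lfloor>b * orb n b\<rfloor>)"
    by (auto simp: orb_Suc digit_def)
  then show ?case by simp
qed

text \<open>
  The orbit function rises by at most \<open>1\<close> on a piece, with slope at least \<open>x * w ^ n\<close>. The bound is passed to the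
  right end \<open>r\<close>, which itself need not belong to the piece.
\<close>
lemma piece_length:
  assumes "0 \<le> u" "u < r" "\<And>w. u < w \<Longrightarrow> w < r \<Longrightarrow> orb (Suc n) w \<noteq> 0"
  shows "(r - u) * x * r ^ n \<le> 1"
proof (rule tendsto_upperbound)
  show "((\<lambda>w. (w - u) * x * w ^ n) \<longlongrightarrow> (r - u) * x * r ^ n) (at_left r)"
    by (intro tendsto_intros)
  show "\<forall>\<^sub>F w in at_left r. (w - u) * x * w ^ n \<le> 1"
    using eventually_at_left_real[OF \<open>u < r\<close>]
  proof eventually_elim
    case (elim w)
    have "same_digits (Suc n) u w"
      by (rule same_digits_if_no_zero) (use elim assms in auto)
    then have "(w - u) * x * w ^ n \<le> orb (Suc n) w - orb (Suc n) u"
      by (rule orb_diff_lower) (use elim assms in auto)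
    then show ?case using orb_bounds[of "Suc n" w] orb_bounds[of "Suc n" u] by linarith
  qed
qed simp

text \<open>
  The weight \<open>1 / v ^ Suc j\<close> is, up to a constant, a lower bound for the gap to the left of \<open>v\<close>, so the sum of
  weights is controlled by the length of the interval.
\<close>
lemma sum_fresh_zeros_tail_le:
  fixes j :: nat
  assumes "1 < s" "s \<le> t"
  defines "D \<equiv> fresh_zeros j s t"
  shows "(\<Sum>v\<in>D - {Min D}. 1 / v ^ Suc j) \<le> (t - s) / (s - 1)"
proof (cases "D = {}")
  case False
  have fin: "finite D" using assms finite_fresh_zeros by simp
  have sub: "D \<subseteq> {s<..t}" by (auto simp: D_def fresh_zeros_def)
  have "(\<Sum>v\<in>D - {Min D}. (s - 1) / v ^ Suc j) \<le> Max D - Min D"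
  proof (rule sum_le_spread[OF fin False])
    fix u v assume uv: "u \<in> D" "v \<in> D" "u < v"
    then have "(u - 1) / v ^ Suc j \<le> v - u"
      by (intro fresh_zero_gap[of u v j s t]) (use assms in \<open>auto simp: D_def fresh_zeros_def\<close>)
    moreover have "(s - 1) / v ^ Suc j \<le> (u - 1) / v ^ Suc j"
      using uv sub assms by (intro divide_right_mono) auto
    ultimately show "(s - 1) / v ^ Suc j \<le> v - u" by linarith
  qed
  also have "Max D \<le> t" "s \<le> Min D" using sub fin False Max_in[of D] Min_in[of D] by auto
  then have "Max D - Min D \<le> t - s" by linarith
  finally have "(s - 1) * (\<Sum>v\<in>D - {Min D}. 1 / v ^ Suc j) \<le> t - s"
    by (simp add: sum_distrib_left)
  then show ?thesis using assms by (simp add: field_simps)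
qed (use assms in simp)

lemma sum_fresh_zeros_le:
  assumes "1 < s" "s \<le> t" "j < m"
  shows "(\<Sum>v\<in>fresh_zeros j s t. 1 / v ^ m) \<le> 1 / s ^ m + (t - s) / (s - 1) * (1 / s) ^ (m - Suc j)"
proof -
  define D where "D = fresh_zeros j s t"
  have fin: "finite D" using assms finite_fresh_zeros by (simp add: D_def)
  have sub: "D \<subseteq> {s<..t}" by (auto simp: D_def fresh_zeros_def)
  have le: "1 / v ^ m \<le> 1 / v ^ Suc j * (1 / s) ^ (m - Suc j)" if "v \<in> D" for v
  proof -
    have v: "s < v" using that sub by auto
    have "1 / v ^ m = 1 / v ^ Suc j * (1 / v) ^ (m - Suc j)"
      using assms by (simp add: power_one_over power_add[symmetric] del: power_Suc)
    also have "\<dots> \<le> 1 / v ^ Suc j * (1 / s) ^ (m - Suc j)"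
      using v assms by (intro mult_left_mono power_mono frac_le) auto
    finally show ?thesis .
  qed
  show ?thesis
  proof (cases "D = {}")
    case False
    then have M: "Min D \<in> D" using fin by simp
    have "(\<Sum>v\<in>D. 1 / v ^ m) = 1 / Min D ^ m + (\<Sum>v\<in>D - {Min D}. 1 / v ^ m)"
      using fin M by (rule sum.remove)
    also have "1 / Min D ^ m \<le> 1 / s ^ m"
      using M sub assms by (intro frac_le power_mono) auto
    also have "(\<Sum>v\<in>D - {Min D}. 1 / v ^ m) \<le> (\<Sum>v\<in>D - {Min D}. 1 / v ^ Suc j * (1 / s) ^ (m - Suc j))"
      by (intro sum_mono le) auto
    also have "\<dots> = (\<Sum>v\<in>D - {Min D}. 1 / v ^ Suc j) * (1 / s) ^ (m - Suc j)"
      by (simp add: sum_distrib_right)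
    also have "\<dots> \<le> (t - s) / (s - 1) * (1 / s) ^ (m - Suc j)"
      using sum_fresh_zeros_tail_le[of s t j] assms unfolding D_def by (intro mult_right_mono) auto
    finally show ?thesis by (simp add: D_def)
  qed (use assms in \<open>simp add: D_def\<close>)
qed

lemma linear_over_power_le:
  assumes "1 < (s::real)"
  shows "real m / s ^ m \<le> 1 / (s - 1)"
proof -
  have "1 + real m * (s - 1) \<le> s ^ m"
    using Bernoulli_inequality[of "s - 1" m] assms by simp
  then show ?thesis using assms by (simp add: field_simps)
qed

lemma sum_geometric_inverse_le:
  assumes "1 < (s::real)"
  shows "(\<Sum>i<k. (1 / s) ^ i) \<le> s / (s - 1)"
proof -
  have "(\<Sum>i<k. (1 / s) ^ i) = (1 - (1 / s) ^ k) / (1 - 1 / s)"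
    using assms by (simp add: sum_gp_strict)
  also have "\<dots> \<le> 1 / (1 - 1 / s)"
    using assms by (intro divide_right_mono) auto
  also have "\<dots> = s / (s - 1)" using assms by (simp add: field_simps)
  finally show ?thesis .
qed

text \<open>
  Measured with weights of stage \<open>m\<close>, the zeros that were fresh at an earlier stage \<open>j\<close> have, apart
  from the least one, total weight at most of order \<open>s ^ j / s ^ m\<close>. Hence the sum over all
  stages stays bounded as \<open>m\<close> grows. The least fresh zeros of all stages together contribute at most \<open>m / s ^ m\<close>, which is bounded by Bernoulli's inequality.
\<close>
lemma sum_zeros_le:
  assumes "1 < s" "s \<le> t"
  shows "(\<Sum>v\<in>zeros m s t. 1 / v ^ m) \<le> 1 / (s - 1) + (t - s) / (s - 1) * (s / (s - 1))"
proof -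
  have "(\<Sum>v\<in>zeros m s t. 1 / v ^ m) = (\<Sum>j<m. \<Sum>v\<in>fresh_zeros j s t. 1 / v ^ m)"
    using assms by (simp add: sum_zeros)
  also have "\<dots> \<le> (\<Sum>j<m. 1 / s ^ m + (t - s) / (s - 1) * (1 / s) ^ (m - Suc j))"
    using assms by (intro sum_mono sum_fresh_zeros_le) auto
  also have "\<dots> = real m / s ^ m + (t - s) / (s - 1) * (\<Sum>j<m. (1 / s) ^ (m - Suc j))"
    by (simp add: sum.distrib sum_distrib_left)
  also have "(\<Sum>j<m. (1 / s) ^ (m - Suc j)) = (\<Sum>j<m. (1 / s) ^ j)"
    by (rule sum.nat_diff_reindex)
  also have "real m / s ^ m + (t - s) / (s - 1) * (\<Sum>j<m. (1 / s) ^ j) \<le>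
      1 / (s - 1) + (t - s) / (s - 1) * (s / (s - 1))"
    using assms by (intro add_mono linear_over_power_le mult_left_mono sum_geometric_inverse_le) auto
  finally show ?thesis .
qed

text \<open>
  On a piece of \<open>orb m\<close> that starts at \<open>l\<close> the return function \<open>orb m - orb n\<close> has slope of order at least \<open>l ^ m\<close>, so
  values below \<open>r\<close> in modulus occur only within an interval of length \<open>O(r / l ^ m)\<close>. Summing over the pieces, that is, over
  their left ends, gives \<open>O(r)\<close> by the weighted count of zeros.
\<close>
lemma return_measure_le:
  assumes "1 < a" "a \<le> b"
  obtains C where "0 < C"
    "\<And>n m r. n < m \<Longrightarrow> 0 \<le> r \<Longrightarrow> measure lborel {\<beta> \<in> {a..b}. \<bar>orb m \<beta> - orb n \<beta>\<bar> < r} \<le> C * r"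
proof -
  define L where "L = 2 * b / ((1 - 1 / a) * x)"
  define W where "W = 1 + (1 / (a - 1) + (b - a) / (a - 1) * (a / (a - 1)))"
  have ca: "0 < 1 - 1 / a" using assms by simp
  have L: "0 < L" using assms x_pos ca unfolding L_def by (intro divide_pos_pos mult_pos_pos) auto
  have W: "0 < W" using assms unfolding W_def by (intro add_pos_nonneg add_nonneg_nonneg) auto
  have "measure lborel {\<beta> \<in> {a..b}. \<bar>orb m \<beta> - orb n \<beta>\<bar> < r} \<le> (2 * L * W) * r"
    if nm: "n < m" and r: "0 \<le> r" for n m r
  proof -
    obtain k where k: "m = Suc k" "n \<le> k" using nm by (cases m) auto
    define S where "S = {\<beta> \<in> {a..b}. \<bar>orb m \<beta> - orb n \<beta>\<bar> < r}"
    \<comment> \<open>The part of S in the piece that starts at l.\<close>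
    define P where "P = (\<lambda>l. {\<beta> \<in> S. l \<le> \<beta> \<and> (\<forall>w. l < w \<longrightarrow> w \<le> \<beta> \<longrightarrow> orb m w \<noteq> 0)})"
    \<comment> \<open>A bound for the diameter of P l; hence P l lies within this distance of any of its points, such as p l.\<close>
    define \<rho> where "\<rho> = (\<lambda>l. L * r / l ^ m)"
    define p where "p = (\<lambda>l. SOME \<beta>. \<beta> \<in> P l)"
    define Z where "Z = insert a (zeros m a b)"
    have finZ: "finite Z" using assms finite_zeros by (simp add: Z_def)
    have Zge: "a \<le> l" if "l \<in> Z" for l using that by (auto simp: Z_def zeros_def)
    have diam: "v - u \<le> \<rho> l" if uv: "u \<in> P l" "v \<in> P l" "u \<le> v" and l: "l \<in> Z" for u v l
    proof -
      have au: "a \<le> u" "v \<le> b" "l \<le> v" and lu: "l \<le> u" using uv by (auto simp: P_def S_def)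
      have la: "a \<le> l" by (rule Zge[OF l])
      have sd: "same_digits (Suc k) u v"
        by (rule same_digits_if_no_zero) (use uv au assms k in \<open>auto simp: P_def\<close>)
      have "(1 - 1 / a) * ((v - u) * x * (l ^ m / b)) \<le> (1 - 1 / v) * ((v - u) * x * v ^ k)"
      proof (intro mult_mono)
        have "l ^ m \<le> v ^ k * b" unfolding k(1) power_Suc2
          using au lu la assms by (intro mult_mono power_mono) auto
        then show "l ^ m / b \<le> v ^ k" using assms by (simp add: field_simps)
      qed (use au assms uv x_pos la in \<open>auto intro!: frac_le\<close>)
      also have "\<dots> \<le> (orb (Suc k) v - orb (Suc k) u) - (orb n v - orb n u)"
        by (rule orb_diff_diff_lower) (use sd au assms uv k in auto)
      also have "\<dots> \<le> 2 * r" using uv unfolding P_def S_def k by auto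
      finally have "(v - u) * ((1 - 1 / a) * x * (l ^ m / b)) \<le> 2 * r" by (simp add: ac_simps)
      moreover have "0 < (1 - 1 / a) * x * (l ^ m / b)" using ca x_pos la assms by simp
      ultimately have "v - u \<le> 2 * r / ((1 - 1 / a) * x * (l ^ m / b))"
        by (subst pos_le_divide_eq)
      also have "\<dots> = \<rho> l" unfolding \<rho>_def L_def using assms by (simp add: ac_simps)
      finally show ?thesis .
    qed
    have \<rho>0: "0 \<le> \<rho> l" if "l \<in> Z" for l using Zge[OF that] L r assms by (simp add: \<rho>_def)
    have cover: "S \<subseteq> (\<Union>l\<in>Z. {p l - \<rho> l..p l + \<rho> l})"
    proof
      fix \<beta> assume \<beta>: "\<beta> \<in> S"
      define l where "l = Max (Z \<inter> {..\<beta>})"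
      have fin: "finite (Z \<inter> {..\<beta>})" using finZ by simp
      have "a \<in> Z \<inter> {..\<beta>}" using \<beta> by (auto simp: Z_def S_def)
      then have l: "l \<in> Z" "l \<le> \<beta>" using Max_in[OF fin] unfolding l_def by auto
      have "\<beta> \<in> P l"
        unfolding P_def
      proof (clarsimp simp: \<beta> l, rule ccontr)
        fix w assume w: "l < w" "w \<le> \<beta>" "orb m w = 0"
        then have "w \<in> Z \<inter> {..\<beta>}" using \<beta> Zge[OF l(1)] by (auto simp: Z_def zeros_def S_def)
        then show False using Max_ge[OF fin, of w] w unfolding l_def by auto
      qed
      moreover from this have "p l \<in> P l" unfolding p_def by (rule someI)
      ultimately have "\<beta> \<in> {p l - \<rho> l..p l + \<rho> l}"
        using diam[of "p l" l \<beta>] diam[of \<beta> l "p l"] l(1) \<rho>0[OF l(1)]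
        by (cases "p l \<le> \<beta>") auto
      then show "\<beta> \<in> (\<Union>l\<in>Z. {p l - \<rho> l..p l + \<rho> l})" using l(1) by blast
    qed
    have "measure lborel S \<le> measure lborel (\<Union>l\<in>Z. {p l - \<rho> l..p l + \<rho> l})"
      using cover finZ
      by (intro measure_mono_fmeasurable) (auto simp: S_def intro!: fmeasurable.finite_UN fmeasurable_Icc)
    also have "\<dots> \<le> (\<Sum>l\<in>Z. measure lborel {p l - \<rho> l..p l + \<rho> l})"
      using finZ by (intro measure_UNION_le) auto
    also have "\<dots> = (\<Sum>l\<in>Z. (2 * L * r) * (1 / l ^ m))"
      using \<rho>0 by (intro sum.cong) (auto simp: \<rho>_def)
    also have "\<dots> = (2 * L * r) * (\<Sum>l\<in>Z. 1 / l ^ m)" by (rule sum_distrib_left[symmetric])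
    also have "(\<Sum>l\<in>Z. 1 / l ^ m) = 1 / a ^ m + (\<Sum>l\<in>zeros m a b. 1 / l ^ m)"
      using assms finite_zeros unfolding Z_def by (subst sum.insert) (auto simp: zeros_def)
    also have "(2 * L * r) * \<dots> \<le> (2 * L * r) * W"
      using L r assms sum_zeros_le[of a b m] unfolding W_def
      by (intro mult_left_mono add_mono) (auto simp: one_le_power)
    finally show ?thesis by (simp add: S_def ac_simps)
  qed
  with L W show ?thesis by (intro that[of "2 * L * W"]) auto
qed

end

section \<open>Orbits hit every interval with positive proportion\<close>
context beta_orbit
begin

lemma orb_add_eq_power:
  assumes "1 \<le> \<beta>" "\<beta> ^ i * orb k \<beta> < 1"
  shows "orb (k + i) \<beta> = \<beta> ^ i * orb k \<beta>"
  using assms(2)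
proof (induction i)
  case (Suc i)
  have nn: "0 \<le> \<beta> ^ i * orb k \<beta>" using assms(1) orb_bounds by simp
  have "\<beta> ^ i * orb k \<beta> \<le> \<beta> * (\<beta> ^ i * orb k \<beta>)"
    using mult_right_mono[OF assms(1) nn] by simp
  then have "orb (k + i) \<beta> = \<beta> ^ i * orb k \<beta>" using Suc by (simp add: mult.assoc)
  moreover have "digit (k + i) \<beta> = 0"
    unfolding digit_def calculation using Suc.prems nn assms(1) by (auto simp: floor_eq_iff mult.assoc)
  ultimately show ?case by (simp add: orb_Suc mult.assoc)
qed simp

text \<open>
  Let \<open>r\<close> be a fresh zero of stage \<open>j + 1 \<le> n\<close> with a fresh zero before it. The piece of \<open>orb (Suc j)\<close> that ends at \<open>r\<close>
  starts at a zero \<open>q\<close> and is full. As long as \<open>\<beta> ^ i * orb (Suc j) \<beta> < 1\<close>, where \<open>i = n - Suc j\<close>, all the digits in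
  between are \<open>0\<close> and this product is the orbit point of time \<open>n\<close>. So it sweeps out all of \<open>[0,1)\<close> immediately to the right of
  \<open>q\<close>, with slope of order at most \<open>r ^ n\<close>. The interval found is the part of this range where the value lies in \<open>(u,v)\<close>.
\<close>
lemma interval_in_full_piece:
  assumes "1 < a" "a \<le> s" and jn: "j < n" and uv: "0 \<le> u" "u < v" "v < 1"
    and r: "r \<in> fresh_zeros j s t - {Min (fresh_zeros j s t)}"
  obtains p p' where "s \<le> p" "p < p'" "p' < r"
    "\<And>w. p < w \<Longrightarrow> w < r \<Longrightarrow> orb (Suc j) w \<noteq> 0"
    "\<And>\<beta>. p < \<beta> \<Longrightarrow> \<beta> < p' \<Longrightarrow> u < orb n \<beta> \<and> orb n \<beta> < v"
    "(v - u) * ((a - 1) / r ^ n) \<le> p' - p"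
proof -
  have fin: "finite (fresh_zeros j s t)" using assms finite_fresh_zeros by simp
  have r': "orb (Suc j) r = 0" "orb j r \<noteq> 0" "s < r" "r \<le> t" using r by (auto simp: fresh_zeros_def)
  define Q where "Q = {w \<in> zeros (Suc j) s t. w < r}"
  have finQ: "finite Q" using assms finite_zeros by (simp add: Q_def)
  have "Min (fresh_zeros j s t) \<in> Q"
    using Min_in[OF fin] Min_le[OF fin, of r] r fresh_zeros_subset[of j s t]
    by (auto simp: Q_def less_le)
  then have "Max Q \<in> Q" using Max_in[OF finQ] by blast
  define q where "q = Max Q"
  have q: "s < q" "q < r" "orb (Suc j) q = 0"
    using \<open>Max Q \<in> Q\<close> by (auto simp: q_def Q_def zeros_def)
  have q1: "1 < q" using q assms by linarith
  have nz: "orb (Suc j) w \<noteq> 0" if "q < w" "w < r" for w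
  proof
    assume "orb (Suc j) w = 0"
    then have "w \<in> Q" using that q r' by (auto simp: Q_def zeros_def)
    then show False using Max_ge[OF finQ, of w] that by (simp add: q_def)
  qed
  have sdS: "same_digits (Suc j) q w" if "q \<le> w" "w < r" for w
    by (rule same_digits_if_no_zero) (use that nz q1 in auto)
  have sd: "same_digits j q r"
  proof (rule same_digits_if_no_zero)
    fix w assume "q < w" "w \<le> r"
    then show "orb j w \<noteq> 0" using nz[of w] r' orb_Suc_eq_0 by (cases "w = r") auto
  qed (use q q1 in auto)
  \<comment> \<open>G continues orb (Suc j) continuously to the right end r, where orb (Suc j) itself jumps down to 0.\<close>
  define G where "G = (\<lambda>\<beta>. \<beta> * orb j \<beta> - of_int (digit j q))"
  have G: "G \<beta> = orb (Suc j) \<beta>" if "q \<le> \<beta>" "\<beta> < r" for \<beta>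
    using sdS[OF that] by (simp add: G_def orb_Suc same_digits_Suc)
  have "1 \<le> G r"
  proof -
    have "0 < orb j r" using r' orb_bounds[of j r] by linarith
    then have "q * orb j r < r * orb j r" using q by simp
    moreover have "q * orb j q \<le> q * orb j r"
      using orb_diff_mono[OF sd] q q1 by (intro mult_left_mono) auto
    moreover have "q * orb j q = of_int (digit j q)" "r * orb j r = of_int (digit j r)"
      using q r' by (auto simp: orb_Suc)
    ultimately have "digit j q + 1 \<le> digit j r" "G r = of_int (digit j r - digit j q)"
      by (simp_all add: G_def)
    then show ?thesis by linarith
  qed
  \<comment> \<open>The digits after stage j + 1 are 0 up to time n, so the orbit is multiplied by the base i times.\<close>
  define i where "i = n - Suc j"
  have n: "n = Suc j + i" using jn by (simp add: i_def)
  define \<psi> where "\<psi> = (\<lambda>\<beta>. \<beta> ^ i * G \<beta>)"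
  have cont: "continuous_on {q..r} \<psi>"
    using continuous_on_orb[OF sd] q1 unfolding \<psi>_def G_def by (intro continuous_intros) auto
  have \<psi>q: "\<psi> q = 0" using G[of q] q by (simp add: \<psi>_def)
  have "1 * 1 \<le> \<psi> r"
    unfolding \<psi>_def using \<open>1 \<le> G r\<close> q q1 by (intro mult_mono one_le_power) auto
  then have \<psi>r: "1 \<le> \<psi> r" by simp
  obtain p where p: "q \<le> p" "p \<le> r" "\<psi> p = u"
    using IVT'[of \<psi> q u r] cont \<psi>q \<psi>r uv q by auto
  have "continuous_on {p..r} \<psi>" by (rule continuous_on_subset[OF cont]) (use p in auto)
  then obtain p' where p': "p \<le> p'" "p' \<le> r" "\<psi> p' = v"
    using IVT'[of \<psi> p v r] \<psi>r uv p by auto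
  have lt: "p < p'" "p' < r" using p p' uv \<psi>r by (auto simp: less_le)
  have mono: "\<psi> \<alpha> < \<psi> \<beta>" if "q \<le> \<alpha>" "\<alpha> < \<beta>" "\<beta> < r" for \<alpha> \<beta>
  proof -
    have "same_digits (Suc j) \<alpha> \<beta>"
      using sdS[of \<alpha>] sdS[of \<beta>] that same_digits_sym same_digits_trans by (meson le_less_trans less_imp_le order.strict_trans1 order.trans)
    then have "G \<alpha> < G \<beta>" using orb_strict_mono[of "Suc j" \<alpha> \<beta>] G[of \<alpha>] G[of \<beta>] that q1 by simp
    moreover have "0 \<le> G \<alpha>" using G[of \<alpha>] orb_bounds that by simp
    moreover have "\<alpha> ^ i \<le> \<beta> ^ i" using that q1 by (intro power_mono) auto
    moreover have "0 < \<beta> ^ i" using that q1 by simp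
    ultimately show ?thesis unfolding \<psi>_def
      by (smt (verit) mult_less_cancel_left_pos mult_right_mono)
  qed
  have orb_eq: "orb n \<beta> = \<psi> \<beta>" if "q \<le> \<beta>" "\<beta> \<le> p'" for \<beta>
  proof -
    have "\<psi> \<beta> \<le> \<psi> p'" using mono[of \<beta> p'] that lt by (cases "\<beta> = p'") auto
    then have "\<beta> ^ i * orb (Suc j) \<beta> < 1" using p' uv G[of \<beta>] that lt by (simp add: \<psi>_def)
    then show ?thesis using orb_add_eq_power[of \<beta> i "Suc j"] G[of \<beta>] that lt q1 n by (simp add: \<psi>_def)
  qed
  have sdn: "same_digits n p p'"
  proof (rule same_digits_if_no_zero)
    fix w assume "p < w" "w \<le> p'"
    then show "orb n w \<noteq> 0" using orb_eq[of w] mono[of p w] p lt uv by simp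
  qed (use p lt q1 in auto)
  have "v - u = orb n p' - orb n p" using orb_eq p p' lt by simp
  also have "\<dots> \<le> (p' - p) * (\<Sum>k<n. p ^ k)" using orb_diff_upper[OF sdn] p lt q1 by simp
  also have "\<dots> \<le> (p' - p) * (p ^ n / (p - 1))"
    using p lt q1 by (intro mult_left_mono geometric_sum_le) auto
  also have "\<dots> \<le> (p' - p) * (r ^ n / (a - 1))"
    using p lt q1 q assms by (intro mult_left_mono frac_le power_mono) auto
  finally have "(v - u) * ((a - 1) / r ^ n) \<le> p' - p"
    using assms q q1 by (simp add: field_simps)
  moreover have "u < orb n \<beta> \<and> orb n \<beta> < v" if "p < \<beta>" "\<beta> < p'" for \<beta>
    using mono[of p \<beta>] mono[of \<beta> p'] orb_eq[of \<beta>] p p' lt that by auto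
  ultimately show ?thesis
    using p lt nz q by (intro that[of p p']) auto
qed

lemma hitting_measure_ge_sum:
  fixes t :: real
  assumes "1 < a" "a \<le> s" and jn: "j < n" and uv: "0 \<le> u" "u < v" "v < 1"
  defines "D \<equiv> fresh_zeros j s t"
  shows "(v - u) * (a - 1) * (\<Sum>r\<in>D - {Min D}. 1 / r ^ n) \<le>
           measure lborel {\<beta> \<in> {s..t}. u < orb n \<beta> \<and> orb n \<beta> < v}"
proof -
  define D' where "D' = D - {Min D}"
  have fin: "finite D'" using assms finite_fresh_zeros by (simp add: D_def D'_def)
  have "\<exists>p p'. s \<le> p \<and> p < p' \<and> p' < r \<and>
      (\<forall>w. p < w \<longrightarrow> w < r \<longrightarrow> orb (Suc j) w \<noteq> 0) \<and>
      (\<forall>\<beta>. p < \<beta> \<longrightarrow> \<beta> < p' \<longrightarrow> u < orb n \<beta> \<and> orb n \<beta> < v) \<and>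
      (v - u) * ((a - 1) / r ^ n) \<le> p' - p" if "r \<in> D'" for r
    by (rule interval_in_full_piece[OF assms(1-6), of r t]) (use that D_def D'_def in blast)+
  then obtain p p' where *: "\<And>r. r \<in> D' \<Longrightarrow> s \<le> p r \<and> p r < p' r \<and> p' r < r \<and>
      (\<forall>w. p r < w \<longrightarrow> w < r \<longrightarrow> orb (Suc j) w \<noteq> 0) \<and>
      (\<forall>\<beta>. p r < \<beta> \<longrightarrow> \<beta> < p' r \<longrightarrow> u < orb n \<beta> \<and> orb n \<beta> < v) \<and>
      (v - u) * ((a - 1) / r ^ n) \<le> p' r - p r"
    by metis
  have D'0: "orb (Suc j) r = 0" "r \<le> t" if "r \<in> D'" for r
    using that by (auto simp: D'_def D_def fresh_zeros_def)
  have sep: "p' r \<le> p r'" if "r \<in> D'" "r' \<in> D'" "r < r'" for r r'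
    using *[OF that(1)] *[OF that(2)] D'0[OF that(1)] that(3) by (meson linorder_not_less less_imp_le order.trans)
  have disj: "disjoint_family_on (\<lambda>r. {p r<..<p' r}) D'"
    unfolding disjoint_family_on_def
  proof (intro ballI impI)
    fix r r' assume "r \<in> D'" "r' \<in> D'" "r \<noteq> r'"
    then show "{p r<..<p' r} \<inter> {p r'<..<p' r'} = {}"
      using sep[of r r'] sep[of r' r] by (cases "r < r'") auto
  qed
  have "(v - u) * (a - 1) * (\<Sum>r\<in>D'. 1 / r ^ n) = (\<Sum>r\<in>D'. (v - u) * ((a - 1) / r ^ n))"
    by (simp add: sum_distrib_left)
  also have "\<dots> \<le> (\<Sum>r\<in>D'. measure lborel {p r<..<p' r})"
    using * by (intro sum_mono) (simp add: less_imp_le)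
  also have "\<dots> = measure lborel (\<Union>r\<in>D'. {p r<..<p' r})"
    by (rule measure_finite_Union[symmetric]) (use fin disj * in \<open>auto simp: less_imp_le\<close>)
  also have "\<dots> \<le> measure lborel {\<beta> \<in> {s..t}. u < orb n \<beta> \<and> orb n \<beta> < v}"
  proof (rule measure_mono_fmeasurable)
    show "(\<Union>r\<in>D'. {p r<..<p' r}) \<subseteq> {\<beta> \<in> {s..t}. u < orb n \<beta> \<and> orb n \<beta> < v}"
      using * D'0 by fastforce
    show "(\<Union>r\<in>D'. {p r<..<p' r}) \<in> sets lborel"
      using fin by (intro sets.finite_UN) auto
    show "{\<beta> \<in> {s..t}. u < orb n \<beta> \<and> orb n \<beta> < v} \<in> fmeasurable lborel"
      by (rule fmeasurableI2[OF fmeasurable_Icc[of s t]]) auto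
  qed
  finally show ?thesis by (simp add: D'_def)
qed

text \<open>
  The pieces cover \<open>[s,t]\<close>, and the one ending at \<open>r\<close> has length at most \<open>b / (x * r ^ n)\<close>. The term
  \<open>1 / a ^ n\<close> accounts for the last piece, which ends at \<open>t\<close> and not at a zero.
\<close>
lemma interval_length_le_sum:
  assumes "1 < a" "a \<le> s" "s < t" "t \<le> b" "0 < n"
  shows "x * (t - s) / b \<le> 1 / a ^ n + (\<Sum>j<n. \<Sum>r\<in>fresh_zeros j s t. 1 / r ^ n)"
proof -
  obtain N where N: "n = Suc N" using assms gr0_conv_Suc by auto
  define B where "B = insert t (zeros n s t)"
  have fin: "finite (zeros n s t)" using assms finite_zeros by simp
  have w: "r - u \<le> b / x * (1 / r ^ n)" if "r \<in> B" "s \<le> u" "u < r" "B \<inter> {u<..<r} = {}" for u r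
  proof -
    have rt: "s < r" "r \<le> t" using that assms by (auto simp: B_def zeros_def)
    have "(r - u) * x * r ^ N \<le> 1"
    proof (rule piece_length)
      fix w assume "u < w" "w < r"
      then have "w \<notin> B" "s < w" "w \<le> t" using that rt by auto
      then show "orb (Suc N) w \<noteq> 0" using N by (auto simp: B_def zeros_def)
    qed (use that assms in auto)
    moreover have rN: "0 < r ^ N" using rt assms by simp
    ultimately have "r - u \<le> 1 / (x * r ^ N)"
      using x_pos by (simp add: pos_le_divide_eq mult.assoc)
    also have "\<dots> = r / x * (1 / r ^ n)" using N rt assms by simp
    also have "\<dots> \<le> b / x * (1 / r ^ n)"
      using rt assms x_pos by (intro mult_right_mono divide_right_mono) auto
    finally show ?thesis .
  qed
  have "Max B - s \<le> (\<Sum>r\<in>B. b / x * (1 / r ^ n))"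
    by (rule spread_le_sum) (use fin w assms in \<open>auto simp: B_def zeros_def\<close>)
  moreover have "Max B = t" using fin by (intro Max_eqI) (auto simp: B_def zeros_def)
  ultimately have "t - s \<le> b / x * (\<Sum>r\<in>B. 1 / r ^ n)"
    by (simp add: sum_distrib_left)
  also have "(\<Sum>r\<in>B. 1 / r ^ n) \<le> 1 / t ^ n + (\<Sum>r\<in>zeros n s t. 1 / r ^ n)"
    using fin assms unfolding B_def by (cases "t \<in> zeros n s t") (auto simp: insert_absorb)
  also have "1 / t ^ n \<le> 1 / a ^ n" using assms by (intro frac_le power_mono) auto
  finally have "t - s \<le> b / x * (1 / a ^ n + (\<Sum>r\<in>zeros n s t. 1 / r ^ n))"
    using assms x_pos by (simp add: divide_right_mono mult_left_mono)
  then show ?thesis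
    using assms x_pos by (simp add: field_simps sum_zeros)
qed

text \<open>
  Zeros that were fresh before the last \<open>K\<close> stages contribute at most the fraction \<open>O(a ^ (-K))\<close> of the length, up to
  the boundary term \<open>(1 + n) / a ^ n\<close>. So the pieces of stage \<open>n\<close> ending at a zero of one of the last \<open>K\<close> stages
  must cover the rest. The least fresh zero of each
  stage is dropped, because the piece ending there need not start at a zero.
\<close>
lemma sum_late_fresh_zeros_ge:
  assumes "1 < a" "a \<le> s" "s < t" "t \<le> b" "0 < n" "K \<le> n"
  defines "D \<equiv> \<lambda>j. fresh_zeros j s t"
  shows "x * (t - s) / b \<le> (1 + real n) / a ^ n + (t - s) * (a / (a - 1)\<^sup>2 * (1 / a) ^ K) +
     (\<Sum>j\<in>{n-K..<n}. \<Sum>r\<in>D j - {Min (D j)}. 1 / r ^ n)"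
proof -
  have early: "(\<Sum>r\<in>D j. 1 / r ^ n) \<le> 1 / a ^ n + (t - s) / (a - 1) * (1 / a) ^ (n - Suc j)"
    if "j < n" for j
  proof -
    have "(\<Sum>r\<in>D j. 1 / r ^ n) \<le> 1 / s ^ n + (t - s) / (s - 1) * (1 / s) ^ (n - Suc j)"
      unfolding D_def using assms that by (intro sum_fresh_zeros_le) auto
    also have "\<dots> \<le> 1 / a ^ n + (t - s) / (a - 1) * (1 / a) ^ (n - Suc j)"
      using assms by (intro add_mono mult_mono frac_le power_mono) auto
    finally show ?thesis .
  qed
  have late: "(\<Sum>r\<in>D j. 1 / r ^ n) \<le> 1 / a ^ n + (\<Sum>r\<in>D j - {Min (D j)}. 1 / r ^ n)" for j
  proof (cases "D j = {}")
    case False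
    have fin: "finite (D j)" using assms finite_fresh_zeros by (simp add: D_def)
    have M: "Min (D j) \<in> D j" using fin False by simp
    have "1 / Min (D j) ^ n \<le> 1 / a ^ n"
      using M assms by (intro frac_le power_mono) (auto simp: D_def fresh_zeros_def)
    with sum.remove[OF fin M, of "\<lambda>r. 1 / r ^ n"] show ?thesis by simp
  qed (use assms in simp)
  have split: "{..<n} = {..<n-K} \<union> {n-K..<n}" "{..<n-K} \<inter> {n-K..<n} = {}" by auto
  have "(\<Sum>j<n. \<Sum>r\<in>D j. 1 / r ^ n) =
      (\<Sum>j<n-K. \<Sum>r\<in>D j. 1 / r ^ n) + (\<Sum>j\<in>{n-K..<n}. \<Sum>r\<in>D j. 1 / r ^ n)"
    unfolding split(1) by (rule sum.union_disjoint) (use split(2) in auto)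
  also have "\<dots> \<le> (\<Sum>j<n-K. 1 / a ^ n + (t - s) / (a - 1) * (1 / a) ^ (n - Suc j)) +
      (\<Sum>j\<in>{n-K..<n}. 1 / a ^ n + (\<Sum>r\<in>D j - {Min (D j)}. 1 / r ^ n))"
    by (intro add_mono sum_mono early late) auto
  also have "\<dots> = (real (n - K) + real K) / a ^ n + (t - s) / (a - 1) * (\<Sum>j<n-K. (1 / a) ^ (n - Suc j)) +
      (\<Sum>j\<in>{n-K..<n}. \<Sum>r\<in>D j - {Min (D j)}. 1 / r ^ n)"
    using assms(6) by (simp add: sum.distrib sum_distrib_left add_divide_distrib diff_divide_distrib)
  also have "real (n - K) + real K = real n" using assms(6) by simp
  also have "(\<Sum>j<n-K. (1 / a) ^ (n - Suc j)) = (\<Sum>j<n-K. (1 / a) ^ K * (1 / a) ^ (n - K - Suc j))"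
    using assms(6) by (intro sum.cong) (auto simp: power_add[symmetric])
  also have "\<dots> = (1 / a) ^ K * (\<Sum>j<n-K. (1 / a) ^ j)"
    by (subst sum.nat_diff_reindex[symmetric]) (simp add: sum_distrib_left)
  also have "(t - s) / (a - 1) * ((1 / a) ^ K * (\<Sum>j<n-K. (1 / a) ^ j)) \<le>
      (t - s) / (a - 1) * ((1 / a) ^ K * (a / (a - 1)))"
    using assms by (intro mult_left_mono sum_geometric_inverse_le) auto
  also have "\<dots> = (t - s) * (a / (a - 1)\<^sup>2 * (1 / a) ^ K)"
    by (simp add: power2_eq_square)
  finally have "(\<Sum>j<n. \<Sum>r\<in>D j. 1 / r ^ n) \<le> real n / a ^ n +
      (t - s) * (a / (a - 1)\<^sup>2 * (1 / a) ^ K) + (\<Sum>j\<in>{n-K..<n}. \<Sum>r\<in>D j - {Min (D j)}. 1 / r ^ n)"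
    using assms(6) by simp
  then show ?thesis
    using interval_length_le_sum[OF assms(1-5)] by (simp add: D_def add_divide_distrib)
qed

text \<open>
  The constants are arranged as follows: \<open>K\<close> is chosen, independently of \<open>[s,t]\<close>, such that the early zeros account for
  at most a quarter of the length, and \<open>n\<close> is taken so large that the boundary terms account for at most another quarter.
  Each of the last \<open>K\<close> stages bounds the measure of the same hitting set from below, so the sum of these bounds is divided
  by \<open>K\<close>.
\<close>
lemma hitting_measure_ge:
  assumes "1 < a" "a \<le> b"
  obtains c where "0 < c"
    "\<And>s t. a \<le> s \<Longrightarrow> s < t \<Longrightarrow> t \<le> b \<Longrightarrow> \<exists>n0. \<forall>n\<ge>n0. \<forall>u v. 0 \<le> u \<longrightarrow> u < v \<longrightarrow> v \<le> 1 \<longrightarrow>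
       c * (t - s) * (v - u) \<le> measure lborel {\<beta> \<in> {s..t}. u < orb n \<beta> \<and> orb n \<beta> < v}"
proof -
  define A where "A = a / (a - 1)\<^sup>2"
  define e where "e = x / (4 * b)"
  have A: "0 < A" and e: "0 < e" using assms x_pos by (auto simp: A_def e_def)
  have "(\<lambda>K. A * (1 / a) ^ K) \<longlonglongrightarrow> A * 0"
    using assms by (intro tendsto_intros LIMSEQ_power_zero) auto
  then have "\<forall>\<^sub>F K in sequentially. A * (1 / a) ^ K < e"
    using e by (intro order_tendstoD) auto
  then have "\<forall>\<^sub>F K in sequentially. A * (1 / a) ^ K < e \<and> 1 \<le> K"
    using eventually_ge_at_top by (rule eventually_conj)
  then obtain K where K: "A * (1 / a) ^ K < e" "1 \<le> K"
    by (auto simp: eventually_sequentially)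
  define c where "c = (a - 1) * e / K"
  have c: "0 < c" using assms e K by (simp add: c_def)
  have "\<exists>n0. \<forall>n\<ge>n0. \<forall>u v. 0 \<le> u \<longrightarrow> u < v \<longrightarrow> v \<le> 1 \<longrightarrow>
       c * (t - s) * (v - u) \<le> measure lborel {\<beta> \<in> {s..t}. u < orb n \<beta> \<and> orb n \<beta> < v}"
    if st: "a \<le> s" "s < t" "t \<le> b" for s t
  proof -
    have "(\<lambda>n. (1 / a) ^ n + of_nat n * (1 / a) ^ n) \<longlonglongrightarrow> 0 + 0"
      using assms by (intro tendsto_add LIMSEQ_power_zero powser_times_n_limit_0) auto
    then have "(\<lambda>n. (1 + real n) / a ^ n) \<longlonglongrightarrow> 0"
      by (simp add: add_divide_distrib power_one_over field_simps)
    then have "\<forall>\<^sub>F n in sequentially. (1 + real n) / a ^ n < e * (t - s)"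
      using e st by (intro order_tendstoD) auto
    then obtain n1 where n1: "\<And>n. n \<ge> n1 \<Longrightarrow> (1 + real n) / a ^ n < e * (t - s)"
      by (auto simp: eventually_sequentially)
    have "c * (t - s) * (v - u) \<le> measure lborel {\<beta> \<in> {s..t}. u < orb n \<beta> \<and> orb n \<beta> < v}"
      if n: "n \<ge> max n1 K" and uv: "0 \<le> u" "u < v" "v \<le> 1" for n u v
    proof -
      \<comment> \<open>Halving the interval keeps its right end below 1, the supremum of the values on a full piece.\<close>
      define v' where "v' = (u + v) / 2"
      have v': "u < v'" "v' < 1" "v' < v" "v' - u = (v - u) / 2" using uv by (auto simp: v'_def)
      define D where "D = (\<lambda>j. fresh_zeros j s t)"
      define \<mu> where "\<mu> = measure lborel {\<beta> \<in> {s..t}. u < orb n \<beta> \<and> orb n \<beta> < v'}"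
      have "x * (t - s) / b \<le> (1 + real n) / a ^ n + (t - s) * (A * (1 / a) ^ K) +
         (\<Sum>j\<in>{n-K..<n}. \<Sum>r\<in>D j - {Min (D j)}. 1 / r ^ n)"
        unfolding A_def D_def using assms st n K by (intro sum_late_fresh_zeros_ge) auto
      also have "(t - s) * (A * (1 / a) ^ K) \<le> (t - s) * e"
        using K st by (intro mult_left_mono) auto
      also have "(1 + real n) / a ^ n \<le> e * (t - s)" using n1[of n] n by simp
      finally have "x * (t - s) / b \<le> 2 * e * (t - s) + (\<Sum>j\<in>{n-K..<n}. \<Sum>r\<in>D j - {Min (D j)}. 1 / r ^ n)"
        by simp
      moreover have "x * (t - s) / b = 4 * e * (t - s)" using assms by (simp add: e_def)
      ultimately have "2 * e * (t - s) \<le> (\<Sum>j\<in>{n-K..<n}. \<Sum>r\<in>D j - {Min (D j)}. 1 / r ^ n)"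
        by simp
      then have "(v' - u) * (a - 1) * (2 * e * (t - s)) \<le>
          (v' - u) * (a - 1) * (\<Sum>j\<in>{n-K..<n}. \<Sum>r\<in>D j - {Min (D j)}. 1 / r ^ n)"
        using assms v' by (intro mult_left_mono) auto
      also have "\<dots> = (\<Sum>j\<in>{n-K..<n}. (v' - u) * (a - 1) * (\<Sum>r\<in>D j - {Min (D j)}. 1 / r ^ n))"
        by (simp add: sum_distrib_left)
      also have "\<dots> \<le> (\<Sum>j\<in>{n-K..<n}. \<mu>)"
        unfolding \<mu>_def D_def using assms st uv v'
        by (intro sum_mono hitting_measure_ge_sum) auto
      also have "\<dots> = K * \<mu>" using n by simp
      finally have "c * (t - s) * (v - u) \<le> \<mu>"
        using K v' by (simp add: c_def field_simps)
      also have "\<mu> \<le> measure lborel {\<beta> \<in> {s..t}. u < orb n \<beta> \<and> orb n \<beta> < v}"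
        unfolding \<mu>_def
      proof (rule measure_mono_fmeasurable)
        show "{\<beta> \<in> {s..t}. u < orb n \<beta> \<and> orb n \<beta> < v} \<in> fmeasurable lborel"
          by (rule fmeasurableI2[OF fmeasurable_Icc[of s t]]) auto
      qed (use v' in auto)
      finally show ?thesis .
    qed
    then show ?thesis by blast
  qed
  with c show ?thesis by (rule that)
qed

end

section \<open>A second moment criterion for infinitely many events\<close>
text \<open>
  Let \<open>F N\<close> count the events among the first \<open>N\<close> and let \<open>S N\<close> be the sum of their weights. The upper bounds for the
  measures of intersections give \<open>\<integral> (F N)\<^sup>2 = O((S N)\<^sup>2)\<close>. Suppose the set \<open>B\<close> where \<open>F\<close> stays below some \<open>k\<close> had
  positive measure, and let \<open>R\<close> be close to \<open>B\<close> and such that the lower bound holds on it. Then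
  \<open>\<integral>\<^bsub>R\<^esub> F N\<close> is at least of order \<open>S N\<close>. But \<open>B\<close> contributes only \<open>O(1)\<close> to this integral, and the small set
  \<open>R - B\<close> contributes only a small multiple of \<open>S N\<close> because of the second moment.
\<close>
lemma (in finite_measure) AE_infinite_of_second_moment:
  fixes E :: "nat \<Rightarrow> 'a set" and \<phi> :: "nat \<Rightarrow> real"
  assumes E [measurable]: "\<And>n. E n \<in> sets M"
    and \<phi>: "\<And>n. 0 \<le> \<phi> n" "\<not> summable \<phi>"
    and C: "\<And>n. measure M (E n) \<le> C * \<phi> n"
      "\<And>n m. n \<noteq> m \<Longrightarrow> measure M (E n \<inter> E m) \<le> C * \<phi> n * \<phi> m"
    and c: "0 < c"
    and approx: "\<And>A \<epsilon>. A \<in> sets M \<Longrightarrow> 0 < \<epsilon> \<Longrightarrow>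
      \<exists>R\<in>sets M. measure M (A - R) \<le> \<epsilon> \<and> measure M (R - A) \<le> \<epsilon> \<and>
        (\<exists>n0. \<forall>n\<ge>n0. c * \<phi> n * measure M R \<le> measure M (E n \<inter> R))"
  shows "AE p in M. infinite {n. p \<in> E n}"
proof -
  define S where "S = (\<lambda>N. \<Sum>n<N. \<phi> n)"
  define F where "F = (\<lambda>N p. \<Sum>n<N. indicat_real (E n) p)"
  have F_meas [measurable]: "F N \<in> borel_measurable M" for N
    unfolding F_def by measurable
  have S_mono: "S N \<le> S N'" if "N \<le> N'" for N N'
    unfolding S_def using that \<phi> by (intro sum_mono2) auto
  have S_unbounded: "filterlim S at_top sequentially"
    unfolding filterlim_at_top
  proof
    fix Z
    obtain N where "Z \<le> S N"
      using summableI_nonneg_bounded[of \<phi> Z] \<phi> unfolding S_def by (meson linear)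
    then show "\<forall>\<^sub>F N in sequentially. Z \<le> S N"
      using S_mono unfolding eventually_sequentially by (meson order.trans)
  qed
  have C0: "0 \<le> C"
  proof (rule ccontr)
    assume "\<not> 0 \<le> C"
    then have "\<phi> n = 0" for n
      using C(1)[of n] \<phi>(1)[of n] measure_nonneg[of M "E n"]
      by (smt (verit) mult_neg_pos)
    then have "\<phi> = (\<lambda>_. 0)" by auto
    then show False using \<phi>(2) by simp
  qed
  have F_sq: "(F N p)\<^sup>2 = (\<Sum>n<N. \<Sum>m<N. indicat_real (E n \<inter> E m) p)" for N p
    unfolding F_def power2_eq_square by (simp add: sum_product indicator_inter_arith)
  have F_sq_int: "integrable M (\<lambda>p. (F N p)\<^sup>2)" for N
    unfolding F_sq by (intro Bochner_Integration.integrable_sum integrable_real_indicator)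
      (auto simp: emeasure_eq_measure)
  have second: "(\<integral>p. (F N p)\<^sup>2 \<partial>M) \<le> C * (S N)\<^sup>2 + C * S N" for N
  proof -
    have "(\<integral>p. (F N p)\<^sup>2 \<partial>M) = (\<Sum>n<N. \<Sum>m<N. measure M (E n \<inter> E m))"
      unfolding F_sq
      by (simp add: Bochner_Integration.integral_sum integrable_sum emeasure_eq_measure)
    also have "\<dots> \<le> (\<Sum>n<N. \<Sum>m<N. C * \<phi> n * \<phi> m + (if n = m then C * \<phi> n else 0))"
    proof (intro sum_mono)
      fix n m
      show "measure M (E n \<inter> E m) \<le> C * \<phi> n * \<phi> m + (if n = m then C * \<phi> n else 0)"
        using C(1)[of n] C(2)[of n m] C0 \<phi>(1) by (cases "n = m") (auto intro: add_increasing)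
    qed
    also have "\<dots> = C * (\<Sum>n<N. \<Sum>m<N. \<phi> n * \<phi> m) + C * S N"
      by (simp add: S_def sum.distrib sum_distrib_left mult.assoc)
    also have "(\<Sum>n<N. \<Sum>m<N. \<phi> n * \<phi> m) = (S N)\<^sup>2"
      by (simp add: S_def power2_eq_square sum_product)
    finally show ?thesis .
  qed
  define B where "B = (\<lambda>k::nat. {p \<in> space M. \<forall>N. F N p \<le> k})"
  have B_meas [measurable]: "B k \<in> sets M" for k
    unfolding B_def by measurable
  have B_null: "measure M (B k) = 0" for k
  proof (rule ccontr)
    assume "measure M (B k) \<noteq> 0"
    define \<alpha> where "\<alpha> = measure M (B k)"
    have \<alpha>: "0 < \<alpha>" using \<open>measure M (B k) \<noteq> 0\<close> by (simp add: \<alpha>_def zero_less_measure_iff)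
    \<comment> \<open>With these choices each of the two error terms below is at most a quarter of c times the measure of B k.\<close>
    define \<delta> where "\<delta> = c * \<alpha> / (8 * (C + 1))"
    have \<delta>: "0 < \<delta>" using c \<alpha> C0 by (simp add: \<delta>_def)
    define \<epsilon> where "\<epsilon> = min (\<alpha> / 4) (\<delta> * c * \<alpha>)"
    have \<epsilon>: "0 < \<epsilon>" "\<epsilon> \<le> \<alpha> / 4" "\<epsilon> \<le> \<delta> * c * \<alpha>" using c \<alpha> \<delta> by (auto simp: \<epsilon>_def)
    obtain R n0 where [measurable]: "R \<in> sets M"
      and R: "measure M (B k - R) \<le> \<epsilon>" "measure M (R - B k) \<le> \<epsilon>"
      and n0: "\<And>n. n \<ge> n0 \<Longrightarrow> c * \<phi> n * measure M R \<le> measure M (E n \<inter> R)"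
      using approx[OF B_meas \<epsilon>(1), of k] by blast
    have "\<alpha> \<le> measure M (R \<union> (B k - R))"
      unfolding \<alpha>_def by (intro finite_measure_mono) auto
    also have "\<dots> \<le> measure M R + measure M (B k - R)"
      by (intro measure_Un_le) auto
    finally have \<mu>R: "\<alpha> - \<epsilon> \<le> measure M R" using R by linarith
    have main: "c * (\<alpha> - \<epsilon>) * (1 - S n0 / S N) \<le>
        k * measure M (space M) / S N + \<delta> * (C + C / S N) + \<epsilon> / (4 * \<delta>)"
      if N: "n0 \<le> N" "0 < S N" for N
    proof -
      have S_diff: "S N - S n0 = (\<Sum>n\<in>{n0..<N}. \<phi> n)"
        unfolding S_def lessThan_atLeast0 using N(1) by (subst sum_diff_nat_ivl) auto
      have "c * (\<alpha> - \<epsilon>) * (S N - S n0) \<le> c * measure M R * (S N - S n0)"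
        using \<mu>R c S_mono[OF N(1)] by (intro mult_right_mono mult_left_mono) auto
      also have "\<dots> = (\<Sum>n\<in>{n0..<N}. c * \<phi> n * measure M R)"
        by (simp add: S_diff sum_distrib_left ac_simps)
      also have "\<dots> \<le> (\<Sum>n\<in>{n0..<N}. measure M (E n \<inter> R))"
        using n0 by (intro sum_mono) auto
      also have "\<dots> \<le> (\<Sum>n<N. measure M (E n \<inter> R))"
        by (intro sum_mono2) auto
      also have "\<dots> = (\<integral>p. (\<Sum>n<N. indicat_real (E n \<inter> R) p) \<partial>M)"
        by (simp add: Bochner_Integration.integral_sum emeasure_eq_measure)
      also have "\<dots> \<le> (\<integral>p. k + (\<delta> / S N * (F N p)\<^sup>2 + S N / (4 * \<delta>) * indicat_real (R - B k) p) \<partial>M)"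
      proof (rule integral_mono)
        show "integrable M (\<lambda>p. \<Sum>n<N. indicat_real (E n \<inter> R) p)"
          by (intro Bochner_Integration.integrable_sum) (simp add: emeasure_eq_measure)
        show "integrable M (\<lambda>p. k + (\<delta> / S N * (F N p)\<^sup>2 + S N / (4 * \<delta>) * indicat_real (R - B k) p))"
          using F_sq_int by (simp add: emeasure_eq_measure)
        fix p assume p: "p \<in> space M"
        have FR: "(\<Sum>n<N. indicat_real (E n \<inter> R) p) = F N p * indicat_real R p"
          by (simp add: F_def sum_distrib_right indicator_inter_arith)
        have F0: "0 \<le> F N p" by (simp add: F_def sum_nonneg)
        \<comment> \<open>A form of the inequality of arithmetic and geometric means; it replaces Cauchy-Schwarz on R - B k.\<close>
        have sq: "F N p \<le> \<delta> / S N * (F N p)\<^sup>2 + S N / (4 * \<delta>)"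
        proof -
          have "0 \<le> (2 * \<delta> * F N p - S N)\<^sup>2 / (4 * \<delta> * S N)"
            using \<delta> N by (intro divide_nonneg_pos) auto
          also have "\<dots> = \<delta> / S N * (F N p)\<^sup>2 + S N / (4 * \<delta>) - F N p"
            using \<delta> N by (simp add: power2_eq_square field_simps)
          finally show ?thesis by simp
        qed
        have nn: "0 \<le> \<delta> / S N * (F N p)\<^sup>2" using \<delta> N by simp
        show "(\<Sum>n<N. indicat_real (E n \<inter> R) p) \<le>
            k + (\<delta> / S N * (F N p)\<^sup>2 + S N / (4 * \<delta>) * indicat_real (R - B k) p)"
          unfolding FR
        proof (cases "p \<in> R"; cases "p \<in> B k")
          assume "p \<in> R" "p \<in> B k"
          then show "F N p * indicat_real R p \<le>
            k + (\<delta> / S N * (F N p)\<^sup>2 + S N / (4 * \<delta>) * indicat_real (R - B k) p)"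
            using nn by (auto simp: B_def intro: add_increasing2)
        next
          assume "p \<in> R" "p \<notin> B k"
          then show "F N p * indicat_real R p \<le>
            k + (\<delta> / S N * (F N p)\<^sup>2 + S N / (4 * \<delta>) * indicat_real (R - B k) p)"
            using sq by simp
        qed (use nn in auto)
      qed
      also have "\<dots> = k * measure M (space M) + (\<delta> / S N * (\<integral>p. (F N p)\<^sup>2 \<partial>M) + S N / (4 * \<delta>) * measure M (R - B k))"
        using F_sq_int by (simp add: emeasure_eq_measure)
      also have "\<dots> \<le> k * measure M (space M) + (\<delta> / S N * (C * (S N)\<^sup>2 + C * S N) + S N / (4 * \<delta>) * \<epsilon>)"
        using second R \<delta> N by (intro add_mono mult_left_mono) auto
      finally have "c * (\<alpha> - \<epsilon>) * (S N - S n0) / S N \<le>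
          (k * measure M (space M) + (\<delta> / S N * (C * (S N)\<^sup>2 + C * S N) + S N / (4 * \<delta>) * \<epsilon>)) / S N"
        using N by (intro divide_right_mono) auto
      moreover have "c * (\<alpha> - \<epsilon>) * (S N - S n0) / S N = c * (\<alpha> - \<epsilon>) * (1 - S n0 / S N)"
        using N by (simp add: field_simps)
      moreover have "(k * measure M (space M) + (\<delta> / S N * (C * (S N)\<^sup>2 + C * S N) + S N / (4 * \<delta>) * \<epsilon>)) / S N
          = k * measure M (space M) / S N + \<delta> * (C + C / S N) + \<epsilon> / (4 * \<delta>)"
        using N \<delta> by (simp add: power2_eq_square field_simps)
      ultimately show ?thesis by simp
    qed
    have to0: "(\<lambda>N. z / S N) \<longlonglongrightarrow> 0" for z
      by (rule tendsto_divide_0[OF tendsto_const filterlim_at_top_imp_at_infinity[OF S_unbounded]])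
    have "c * (\<alpha> - \<epsilon>) * (1 - 0) \<le> 0 + \<delta> * (C + 0) + \<epsilon> / (4 * \<delta>)"
    proof (rule tendsto_le[OF sequentially_bot])
      show "(\<lambda>N. c * (\<alpha> - \<epsilon>) * (1 - S n0 / S N)) \<longlonglongrightarrow> c * (\<alpha> - \<epsilon>) * (1 - 0)"
        by (intro tendsto_intros to0)
      show "(\<lambda>N. k * measure M (space M) / S N + \<delta> * (C + C / S N) + \<epsilon> / (4 * \<delta>)) \<longlonglongrightarrow> 0 + \<delta> * (C + 0) + \<epsilon> / (4 * \<delta>)"
        by (intro tendsto_intros to0)
      have "\<forall>\<^sub>F N in sequentially. 0 < S N"
        using S_unbounded by (simp add: filterlim_at_top_dense)
      then show "\<forall>\<^sub>F N in sequentially. c * (\<alpha> - \<epsilon>) * (1 - S n0 / S N) \<le>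
          k * measure M (space M) / S N + \<delta> * (C + C / S N) + \<epsilon> / (4 * \<delta>)"
        using eventually_ge_at_top[of n0] by eventually_elim (rule main)
    qed
    moreover have "c * (3 / 4 * \<alpha>) \<le> c * (\<alpha> - \<epsilon>)" using \<epsilon> c by (intro mult_left_mono) auto
    moreover have "\<delta> * C \<le> c * \<alpha> / 8"
    proof -
      have "\<delta> * C \<le> \<delta> * (C + 1)" using \<delta> by simp
      also have "\<dots> = c * \<alpha> / 8" using C0 by (simp add: \<delta>_def field_simps)
      finally show ?thesis .
    qed
    moreover have "\<epsilon> / (4 * \<delta>) \<le> c * \<alpha> / 4" using \<epsilon>(3) \<delta> by (simp add: field_simps)
    moreover have "0 < c * \<alpha>" using c \<alpha> by simp
    ultimately show False by simp
  qed
  have "AE p in M. p \<notin> B k" for k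
    using B_null[of k] by (intro AE_not_in) (auto simp: null_sets_def emeasure_eq_measure)
  then have "AE p in M. \<forall>k. p \<notin> B k" by (simp add: AE_all_countable)
  then show ?thesis
    using AE_space
  proof eventually_elim
    case (elim p)
    show ?case
    proof
      assume fin: "finite {n. p \<in> E n}"
      have "F N p \<le> card {n. p \<in> E n}" for N
      proof -
        have "F N p = card ({..<N} \<inter> {n. p \<in> E n})"
          unfolding F_def by (simp add: indicator_def sum.If_cases)
        also have "\<dots> \<le> card {n. p \<in> E n}" using fin by (simp add: card_mono)
        finally show ?thesis .
      qed
      then have "p \<in> B (card {n. p \<in> E n})" using elim by (simp add: B_def)
      then show False using elim by blast
    qed
  qed
qed

section \<open>The product of parameter and target space\<close>
text \<open>
  Cover \<open>A\<close> by countably many non-overlapping boxes with small excess, and keep finitely many of them that carry almost all of the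
  measure.
\<close>
lemma approx_by_boxes:
  fixes A :: "'a::euclidean_space set"
  assumes A: "A \<in> sets borel" "A \<subseteq> cbox a b" and \<epsilon>: "0 < \<epsilon>"
  obtains D where "finite D" "\<And>K. K \<in> D \<Longrightarrow> K \<subseteq> cbox a b \<and> K \<noteq> {} \<and> (\<exists>c d. K = cbox c d)"
    "pairwise (\<lambda>S T. negligible (S \<inter> T)) D"
    "measure lborel (A - \<Union>D) \<le> \<epsilon>" "measure lborel (\<Union>D - A) \<le> \<epsilon>"
proof -
  have A_l: "A \<in> lmeasurable"
    by (rule fmeasurableI2[OF lmeasurable_cbox A(2)]) (use A in auto)
  obtain D where D: "countable D" "\<And>K. K \<in> D \<Longrightarrow> K \<subseteq> cbox a b \<and> K \<noteq> {} \<and> (\<exists>c d. K = cbox c d)"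
    and disj: "pairwise (\<lambda>S T. interior S \<inter> interior T = {}) D"
    and cover: "A \<subseteq> \<Union>D" "\<Union>D \<in> lmeasurable" "measure lebesgue (\<Union>D) \<le> measure lebesgue A + \<epsilon>"
    using measurable_outer_intervals_bounded[OF A_l A(2) \<epsilon>] by metis
  have K_l: "K \<in> lmeasurable" if "K \<in> D" for K using D(2)[OF that] by auto
  have fin_l: "\<Union>D' \<in> lmeasurable" if "D' \<subseteq> D" "finite D'" for D'
    using that K_l by (intro fmeasurable.finite_Union) auto
  have fin_b: "\<Union>D' \<in> sets borel" if "D' \<subseteq> D" "finite D'" for D'
    using that D(2) by (intro sets.finite_Union) fastforce+
  have D_b: "\<Union>D \<in> sets borel" using D by (intro sets.countable_Union) fastforce+
  have "measure lebesgue (\<Union>D') \<le> measure lebesgue (\<Union>D)" if "D' \<subseteq> D" "finite D'" for D'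
    using that cover fin_l[OF that] by (intro measure_mono_fmeasurable) (auto simp: fmeasurableD)
  from measure_countable_Union_approachable[OF D(1) \<epsilon> K_l this]
  obtain D' where D': "D' \<subseteq> D" "finite D'" "measure lebesgue (\<Union>D) - \<epsilon> < measure lebesgue (\<Union>D')"
    by metis
  have neg: "negligible (S \<inter> T)" if "S \<in> D'" "T \<in> D'" "S \<noteq> T" for S T
  proof -
    have "convex K" if "K \<in> D" for K using D(2)[OF that] convex_box(1) by metis
    then have "convex S" "convex T" using D'(1) that by auto
    then have "negligible (frontier S \<union> frontier T)"
      by (intro negligible_Un negligible_convex_frontier)
    moreover have "S \<inter> T \<subseteq> frontier S \<union> frontier T"
    proof
      fix p assume p: "p \<in> S \<inter> T"
      then have "p \<in> closure S" "p \<in> closure T" using closure_subset by blast+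
      moreover have "interior S \<inter> interior T = {}" using pairwiseD[OF disj, of S T] D'(1) that by blast
      ultimately show "p \<in> frontier S \<union> frontier T" unfolding frontier_def by blast
    qed
    ultimately show ?thesis by (rule negligible_subset)
  qed
  have "measure lborel (A - \<Union>D') = measure lebesgue (A - \<Union>D')"
    using A fin_b[OF D'(1,2)] by simp
  also have "\<dots> \<le> measure lebesgue (\<Union>D - \<Union>D')"
    using cover A_l fin_l[OF D'(1,2)] by (intro measure_mono_fmeasurable) (auto simp: fmeasurable.Diff fmeasurableD)
  also have "\<dots> = measure lebesgue (\<Union>D) - measure lebesgue (\<Union>D')"
    using cover fin_l[OF D'(1,2)] D'(1) by (intro measurable_measure_Diff) (auto simp: fmeasurableD)
  finally have 1: "measure lborel (A - \<Union>D') \<le> \<epsilon>" using D'(3) by simp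
  have "measure lborel (\<Union>D' - A) = measure lebesgue (\<Union>D' - A)"
    using A fin_b[OF D'(1,2)] by simp
  also have "\<dots> \<le> measure lebesgue (\<Union>D - A)"
    using cover A_l fin_l[OF D'(1,2)] D'(1) by (intro measure_mono_fmeasurable) (auto simp: fmeasurable.Diff fmeasurableD)
  also have "\<dots> = measure lebesgue (\<Union>D) - measure lebesgue A"
    using cover A_l by (intro measurable_measure_Diff) (auto simp: fmeasurableD)
  finally have 2: "measure lborel (\<Union>D' - A) \<le> \<epsilon>" using cover(3) by simp
  show ?thesis
    by (rule that[of D']) (use D D' neg 1 2 in \<open>auto simp: pairwise_def\<close>)
qed

lemma emeasure_lborel_pair:
  fixes B :: "(real \<times> real) set"
  assumes "B \<in> sets borel"
  shows "emeasure lborel B = (\<integral>\<^sup>+\<beta>. emeasure lborel (Pair \<beta> -` B) \<partial>lborel)"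
proof -
  have "B \<in> sets (lborel \<Otimes>\<^sub>M lborel)" unfolding lborel_prod using assms by simp
  from lborel.emeasure_pair_measure_alt[OF this] show ?thesis unfolding lborel_prod .
qed

lemma emeasure_lborel_pair':
  fixes B :: "(real \<times> real) set"
  assumes "B \<in> sets borel"
  shows "emeasure lborel B = (\<integral>\<^sup>+y. emeasure lborel ((\<lambda>\<beta>. (\<beta>, y)) -` B) \<partial>lborel)"
proof -
  have "B \<in> sets (lborel \<Otimes>\<^sub>M lborel)" unfolding lborel_prod using assms by simp
  from lborel_pair.emeasure_pair_measure_alt2[OF this] show ?thesis unfolding lborel_prod .
qed

lemma borel_slice:
  fixes B :: "(real \<times> real) set"
  assumes "B \<in> sets borel"
  shows "(\<lambda>\<beta>. (\<beta>, y)) -` B \<in> sets lborel"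
proof -
  have "B \<in> sets (lborel \<Otimes>\<^sub>M lborel)" unfolding lborel_prod using assms by simp
  then show ?thesis by (rule sets_Pair2)
qed

lemma measurable_fst_real [measurable]: "fst \<in> borel_measurable (borel :: (real \<times> real) measure)"
  by (intro borel_measurable_continuous_onI continuous_on_fst continuous_on_id)

lemma measurable_snd_real [measurable]: "snd \<in> borel_measurable (borel :: (real \<times> real) measure)"
  by (intro borel_measurable_continuous_onI continuous_on_snd continuous_on_id)

lemma measure_cbox_real_pair:
  assumes "s \<le> t" "u \<le> v"
  shows "measure lborel (cbox (s, u) (t, v)) = (t - s) * (v - u :: real)"
proof -
  have "emeasure lborel (cbox (s, u) (t, v)) = ennreal ((t - s) * (v - u))"
    using assms by (subst emeasure_lborel_cbox) (auto simp: Basis_prod_def prod.union_disjoint prod.reindex inj_on_def)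
  then show ?thesis using assms by (simp add: measure_def)
qed

context beta_orbit
begin

definition near :: "real \<Rightarrow> nat \<Rightarrow> (real \<times> real) set" where
  "near r n = {p. \<bar>orb n (fst p) - snd p\<bar> < r}"

lemma near_borel [measurable, simp]: "near r n \<in> sets borel"
proof -
  have "{p \<in> space borel. \<bar>orb n (fst p) - snd p\<bar> < r} \<in> sets (borel :: (real \<times> real) measure)"
    by measurable
  then show ?thesis by (simp add: near_def)
qed

lemma near_measure_le:
  assumes "a \<le> b" "0 \<le> r"
  shows "measure lborel (cbox (a, 0) (b, 1) \<inter> near r n) \<le> 2 * (b - a) * r"
proof -
  let ?B = "cbox (a, 0) (b, 1) \<inter> near r n"
  have "emeasure lborel ?B = (\<integral>\<^sup>+\<beta>. emeasure lborel (Pair \<beta> -` ?B) \<partial>lborel)"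
    by (rule emeasure_lborel_pair) simp
  also have "\<dots> \<le> (\<integral>\<^sup>+\<beta>. ennreal (2 * r) * indicator {a..b} \<beta> \<partial>lborel)"
  proof (rule nn_integral_mono)
    fix \<beta> :: real
    have "emeasure lborel (Pair \<beta> -` ?B) \<le> emeasure lborel {orb n \<beta> - r..orb n \<beta> + r}"
      by (rule emeasure_mono) (auto simp: near_def)
    moreover have "Pair \<beta> -` ?B = {}" if "\<beta> \<notin> {a..b}" using that by (auto simp: mem_box)
    ultimately show "emeasure lborel (Pair \<beta> -` ?B) \<le> ennreal (2 * r) * indicator {a..b} \<beta>"
      using assms by (auto split: split_indicator)
  qed
  also have "\<dots> = ennreal (2 * (b - a) * r)"
    using assms by (subst nn_integral_cmult_indicator) (auto simp: ennreal_mult'[symmetric] ac_simps)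
  finally show ?thesis using assms by (simp add: measure_def enn2real_leI)
qed

text \<open>
  Fubini, integrating over \<open>y\<close> first: for fixed \<open>\<beta>\<close> the fibre is contained in both of two intervals and is empty unless their
  centres are closer than \<open>r + r'\<close>.
\<close>
lemma near_Int_measure_le:
  assumes C: "\<And>n m r. n < m \<Longrightarrow> 0 \<le> r \<Longrightarrow> measure lborel {\<beta> \<in> {a..b}. \<bar>orb m \<beta> - orb n \<beta>\<bar> < r} \<le> C * r"
    and "n < m" "0 \<le> r" "0 \<le> r'" "0 < C"
  shows "measure lborel (cbox (a, 0) (b, 1) \<inter> near r n \<inter> near r' m) \<le> 4 * C * r * r'"
proof -
  let ?B = "cbox (a, 0) (b, 1) \<inter> near r n \<inter> near r' m"
  let ?S = "{\<beta> \<in> {a..b}. \<bar>orb m \<beta> - orb n \<beta>\<bar> < r + r'}"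
  have S_m: "?S \<in> fmeasurable lborel"
    by (rule fmeasurableI2[OF fmeasurable_Icc[of a b]]) auto
  have "emeasure lborel ?B = (\<integral>\<^sup>+\<beta>. emeasure lborel (Pair \<beta> -` ?B) \<partial>lborel)"
    by (rule emeasure_lborel_pair) simp
  also have "\<dots> \<le> (\<integral>\<^sup>+\<beta>. ennreal (2 * min r r') * indicator ?S \<beta> \<partial>lborel)"
  proof (rule nn_integral_mono)
    fix \<beta> :: real
    have "emeasure lborel (Pair \<beta> -` ?B) \<le> emeasure lborel {orb n \<beta> - r..orb n \<beta> + r}"
      by (rule emeasure_mono) (auto simp: near_def)
    moreover have "emeasure lborel (Pair \<beta> -` ?B) \<le> emeasure lborel {orb m \<beta> - r'..orb m \<beta> + r'}"
      by (rule emeasure_mono) (auto simp: near_def)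
    moreover have "Pair \<beta> -` ?B = {}" if "\<beta> \<notin> ?S" using that by (auto simp: mem_box near_def)
    ultimately show "emeasure lborel (Pair \<beta> -` ?B) \<le> ennreal (2 * min r r') * indicator ?S \<beta>"
      using assms by (cases "\<beta> \<in> ?S") (auto simp: min_def)
  qed
  also have "\<dots> = ennreal (2 * min r r') * emeasure lborel ?S"
    using S_m by (subst nn_integral_cmult_indicator) (auto simp: fmeasurableD)
  also have "\<dots> = ennreal (2 * min r r' * measure lborel ?S)"
    using S_m assms by (simp add: emeasure_eq_measure2 ennreal_mult)
  finally have "measure lborel ?B \<le> 2 * min r r' * measure lborel ?S"
    using assms by (simp add: measure_def enn2real_leI)
  also have "\<dots> \<le> 2 * min r r' * (C * (r + r'))"
    using assms by (intro mult_left_mono) auto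
  also have "\<dots> = 2 * C * (min r r' * r + min r r' * r')" by (simp add: algebra_simps)
  also have "\<dots> \<le> 2 * C * (r' * r + r * r')"
    using assms by (intro mult_left_mono add_mono mult_right_mono) auto
  finally show ?thesis by simp
qed

text \<open>
  Fubini, integrating over \<open>\<beta>\<close> first: for fixed \<open>y\<close> the fibre is a hitting set of the interval of radius \<open>r\<close> about \<open>y\<close>. Cutting
  that interval down to \<open>[0,1]\<close> leaves a length of at least \<open>r / 2\<close>, whence the factor \<open>1 / 2\<close>.
\<close>
lemma near_box_measure_ge:
  assumes c: "0 < c" and st: "s \<le> t" and uv: "0 \<le> u" "u \<le> v" "v \<le> 1" and r: "0 < r" "r \<le> 1"
    and hit: "\<And>u v. 0 \<le> u \<Longrightarrow> u < v \<Longrightarrow> v \<le> 1 \<Longrightarrow>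
       c * (t - s) * (v - u) \<le> measure lborel {\<beta> \<in> {s..t}. u < orb n \<beta> \<and> orb n \<beta> < v}"
  shows "c / 2 * r * measure lborel (cbox (s, u) (t, v)) \<le> measure lborel (near r n \<inter> cbox (s, u) (t, v))"
proof -
  let ?K = "cbox (s, u) (t, v)"
  let ?B = "near r n \<inter> ?K"
  have B_f: "?B \<in> fmeasurable lborel"
    by (rule fmeasurableI2[of ?K]) (auto intro: fmeasurableI emeasure_lborel_cbox_finite)
  have "ennreal (c / 2 * r * ((t - s) * (v - u))) = (\<integral>\<^sup>+y. ennreal (c / 2 * r * (t - s)) * indicator {u..v} y \<partial>lborel)"
    using uv st r c by (subst nn_integral_cmult_indicator) (auto simp: ennreal_mult'[symmetric] ac_simps)
  also have "\<dots> \<le> (\<integral>\<^sup>+y. emeasure lborel ((\<lambda>\<beta>. (\<beta>, y)) -` ?B) \<partial>lborel)"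
  proof (rule nn_integral_mono)
    fix y :: real
    show "ennreal (c / 2 * r * (t - s)) * indicator {u..v} y \<le> emeasure lborel ((\<lambda>\<beta>. (\<beta>, y)) -` ?B)"
    proof (cases "y \<in> {u..v}")
      case True
      define u' v' where "u' = max 0 (y - r)" and "v' = min 1 (y + r)"
      have y: "0 \<le> y" "y \<le> 1" using True uv by auto
      have uv': "0 \<le> u'" "v' \<le> 1" "r / 2 \<le> v' - u'" using y r by (auto simp: u'_def v'_def max_def min_def)
      let ?H = "{\<beta> \<in> {s..t}. u' < orb n \<beta> \<and> orb n \<beta> < v'}"
      have H_f: "?H \<in> fmeasurable lborel"
        by (rule fmeasurableI2[OF fmeasurable_Icc[of s t]]) auto
      have "c / 2 * r * (t - s) = c * (t - s) * (r / 2)" by simp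
      also have "\<dots> \<le> c * (t - s) * (v' - u')"
        using uv' c st by (intro mult_left_mono) auto
      also have "\<dots> \<le> measure lborel ?H"
        using uv' r by (intro hit) auto
      finally have "ennreal (c / 2 * r * (t - s)) \<le> emeasure lborel ?H"
        using H_f by (simp add: emeasure_eq_measure2 ennreal_leI)
      also have "\<dots> \<le> emeasure lborel ((\<lambda>\<beta>. (\<beta>, y)) -` ?B)"
      proof (rule emeasure_mono)
        show "?H \<subseteq> (\<lambda>\<beta>. (\<beta>, y)) -` ?B"
          using True by (auto simp: near_def u'_def v'_def)
        show "(\<lambda>\<beta>. (\<beta>, y)) -` ?B \<in> sets lborel"
          by (rule borel_slice) simp
      qed
      finally show ?thesis using True by simp
    qed simp
  qed
  also have "\<dots> = emeasure lborel ?B"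
    by (rule emeasure_lborel_pair'[symmetric]) simp
  also have "\<dots> = ennreal (measure lborel ?B)"
    using B_f by (rule emeasure_eq_measure2)
  finally show ?thesis
    using st uv by (simp add: measure_cbox_real_pair)
qed

end

section \<open>The divergent and the convergent case\<close>
context beta_orbit
begin

text \<open>
  The second moment criterion is applied to the rectangle with Lebesgue measure. Times are shifted by one against
  the radii, so that the series of radii is summed from \<open>0\<close> as in the criterion.
\<close>
lemma AE_near_infinitely_often:
  assumes ab: "1 < a" "a \<le> b"
    and \<phi>: "\<And>n. 0 < \<phi> n" "\<And>n. \<phi> n \<le> 1" "\<not> summable \<phi>"
  shows "AE \<beta> in lborel. \<beta> \<in> {a..b} \<longrightarrow>
    (AE y in lborel. y \<in> {0..1} \<longrightarrow> infinite {n. \<bar>orb (Suc n) \<beta> - y\<bar> < \<phi> n})"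
proof -
  obtain C where C: "0 < C"
    "\<And>n m r. n < m \<Longrightarrow> 0 \<le> r \<Longrightarrow> measure lborel {\<beta> \<in> {a..b}. \<bar>orb m \<beta> - orb n \<beta>\<bar> < r} \<le> C * r"
    using return_measure_le[OF ab] by blast
  obtain c where c: "0 < c" and hit:
    "\<And>s t. a \<le> s \<Longrightarrow> s < t \<Longrightarrow> t \<le> b \<Longrightarrow> \<exists>n0. \<forall>n\<ge>n0. \<forall>u v. 0 \<le> u \<longrightarrow> u < v \<longrightarrow> v \<le> 1 \<longrightarrow>
       c * (t - s) * (v - u) \<le> measure lborel {\<beta> \<in> {s..t}. u < orb n \<beta> \<and> orb n \<beta> < v}"
    using hitting_measure_ge[OF ab] by blast
  define X where "X = cbox (a, 0) (b, 1::real)"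
  define M where "M = restrict_space lborel X"
  define E where "E = (\<lambda>n. X \<inter> near (\<phi> n) (Suc n))"
  have [measurable, simp]: "X \<in> sets borel" by (simp add: X_def)
  have X_fin: "emeasure lborel X < \<infinity>" unfolding X_def by (rule emeasure_lborel_cbox_finite)
  have sets_M: "A \<in> sets M \<longleftrightarrow> A \<subseteq> X \<and> A \<in> sets borel" for A
    by (simp add: M_def sets_restrict_space_iff)
  have meas_M: "measure M A = measure lborel A" if "A \<subseteq> X" for A
    unfolding M_def using that by (intro measure_restrict_space) auto
  have space_M: "space M = X" by (simp add: M_def space_restrict_space)
  interpret finite_measure M
  proof
    have "emeasure M (space M) = emeasure lborel X"
      unfolding space_M unfolding M_def by (rule emeasure_restrict_space) auto
    then show "emeasure M (space M) \<noteq> \<infinity>" using X_fin by simp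
  qed
  have E_M: "E n \<in> sets M" for n by (auto simp: sets_M E_def)
  have f_l: "A \<in> lmeasurable" if "A \<in> sets M" for A
    by (rule fmeasurableI2[of X]) (use that in \<open>auto simp: sets_M X_def\<close>)
  define C' where "C' = 4 * C + 2 * (b - a)"
  have "AE p in M. infinite {n. p \<in> E n}"
  proof (rule AE_infinite_of_second_moment[where C = C' and c = "c / 2" and \<phi> = \<phi>])
    show "measure M (E n) \<le> C' * \<phi> n" for n
    proof -
      have "measure M (E n) \<le> 2 * (b - a) * \<phi> n"
        using near_measure_le[OF ab(2), of "\<phi> n" "Suc n"] \<phi>(1)[of n] by (simp add: meas_M E_def X_def)
      also have "\<dots> \<le> C' * \<phi> n"
        using C ab \<phi>(1)[of n] by (intro mult_right_mono) (auto simp: C'_def)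
      finally show ?thesis .
    qed
    show "measure M (E n \<inter> E m) \<le> C' * \<phi> n * \<phi> m" if "n \<noteq> m" for n m
      using that
    proof (induction n m rule: linorder_wlog)
      case (le n m)
      have "E n \<inter> E m = X \<inter> near (\<phi> n) (Suc n) \<inter> near (\<phi> m) (Suc m)" by (auto simp: E_def)
      then have "measure M (E n \<inter> E m) \<le> 4 * C * \<phi> n * \<phi> m"
        using near_Int_measure_le[OF C(2), of "Suc n" "Suc m" "\<phi> n" "\<phi> m"] \<phi>(1)[of n] \<phi>(1)[of m] C(1) le
        by (subst meas_M) (auto simp: X_def)
      also have "\<dots> \<le> C' * \<phi> n * \<phi> m"
        using C ab \<phi>(1)[of n] \<phi>(1)[of m] by (intro mult_right_mono) (auto simp: C'_def)
      finally show ?case .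
    next
      case (sym n m)
      then show ?case by (simp add: Int_commute ac_simps)
    qed
    show "\<exists>R\<in>sets M. measure M (A - R) \<le> \<epsilon> \<and> measure M (R - A) \<le> \<epsilon> \<and>
        (\<exists>n0. \<forall>n\<ge>n0. c / 2 * \<phi> n * measure M R \<le> measure M (E n \<inter> R))"
      if A: "A \<in> sets M" and \<epsilon>: "0 < \<epsilon>" for A \<epsilon>
    proof -
      have A': "A \<in> sets borel" "A \<subseteq> cbox (a, 0) (b, 1)" using A by (auto simp: sets_M X_def)
      obtain D where D: "finite D" "\<And>K. K \<in> D \<Longrightarrow> K \<subseteq> X \<and> K \<noteq> {} \<and> (\<exists>p q. K = cbox p q)"
        "pairwise (\<lambda>S T. negligible (S \<inter> T)) D"
        "measure lborel (A - \<Union>D) \<le> \<epsilon>" "measure lborel (\<Union>D - A) \<le> \<epsilon>"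
        using approx_by_boxes[OF A' \<epsilon>] unfolding X_def by metis
      have K_M: "K \<in> sets M" if "K \<in> D" for K using D(2)[OF that] by (auto simp: sets_M)
      have R_M: "\<Union>D \<in> sets M" using D(1) K_M by (intro sets.finite_Union) auto
      have box: "\<exists>n0. \<forall>n\<ge>n0. c / 2 * \<phi> n * measure M K \<le> measure M (E n \<inter> K)" if K: "K \<in> D" for K
      proof -
        obtain s u t v where K_eq: "K = cbox (s, u) (t, v)" using D(2)[OF K] by auto
        have KX: "K \<subseteq> X" and "K \<noteq> {}" using D(2)[OF K] by auto
        then have "(s, u) \<in> K" "(t, v) \<in> K" and stuv: "s \<le> t" "u \<le> v"
          by (auto simp: K_eq)
        then have "(s, u) \<in> X" "(t, v) \<in> X" using KX by auto
        then have bds: "a \<le> s" "t \<le> b" "0 \<le> u" "v \<le> 1" by (auto simp: X_def)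
        have m: "measure M K = measure lborel K" by (rule meas_M[OF KX])
        have mE: "measure M (E n \<inter> K) = measure lborel (near (\<phi> n) (Suc n) \<inter> K)" for n
        proof -
          have "E n \<inter> K = near (\<phi> n) (Suc n) \<inter> K" using KX by (auto simp: E_def)
          then show ?thesis using KX by (subst meas_M) auto
        qed
        show ?thesis
        proof (cases "s < t")
          case True
          obtain n0 where n0: "\<And>n u v. n0 \<le> n \<Longrightarrow> 0 \<le> u \<Longrightarrow> u < v \<Longrightarrow> v \<le> 1 \<Longrightarrow>
             c * (t - s) * (v - u) \<le> measure lborel {\<beta> \<in> {s..t}. u < orb n \<beta> \<and> orb n \<beta> < v}"
            using hit[OF bds(1) True bds(2)] by blast
          have "c / 2 * \<phi> n * measure M K \<le> measure M (E n \<inter> K)" if "n0 \<le> n" for n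
            unfolding m mE unfolding K_eq
            using that by (intro near_box_measure_ge c stuv bds \<phi> n0) auto
          then show ?thesis by blast
        next
          case False
          then have "measure M K = 0"
            using stuv unfolding m unfolding K_eq by (simp add: measure_cbox_real_pair)
          then show ?thesis by simp
        qed
      qed
      then obtain n0 where n0: "\<And>K n. K \<in> D \<Longrightarrow> n0 K \<le> n \<Longrightarrow> c / 2 * \<phi> n * measure M K \<le> measure M (E n \<inter> K)"
        by metis
      define N where "N = Max (insert 0 (n0 ` D))"
      have N: "n0 K \<le> N" if "K \<in> D" for K using D(1) that by (simp add: N_def)
      have "c / 2 * \<phi> n * measure M (\<Union>D) \<le> measure M (E n \<inter> \<Union>D)" if n: "N \<le> n" for n
      proof -
        have "measure M (\<Union>D) \<le> (\<Sum>K\<in>D. measure M K)"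
          using measure_UNION_le[OF D(1), of "\<lambda>K. K" M] K_M by simp
        then have "c / 2 * \<phi> n * measure M (\<Union>D) \<le> c / 2 * \<phi> n * (\<Sum>K\<in>D. measure M K)"
          using c \<phi>(1)[of n] by (intro mult_left_mono) auto
        also have "\<dots> = (\<Sum>K\<in>D. c / 2 * \<phi> n * measure M K)" by (rule sum_distrib_left)
        also have "\<dots> \<le> (\<Sum>K\<in>D. measure M (E n \<inter> K))"
          using n0 N n by (intro sum_mono) (meson order.trans)
        also have "\<dots> = (\<Sum>K\<in>D. measure lebesgue (E n \<inter> K))"
        proof (rule sum.cong)
          fix K assume "K \<in> D"
          then have "E n \<inter> K \<in> sets M" using E_M K_M by auto
          then show "measure M (E n \<inter> K) = measure lebesgue (E n \<inter> K)"
            by (simp add: meas_M sets_M)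
        qed simp
        also have "\<dots> = measure lebesgue (\<Union>K\<in>D. E n \<inter> K)"
        proof (rule measure_negligible_finite_Union_image[symmetric, OF D(1)])
          show "E n \<inter> K \<in> lmeasurable" if "K \<in> D" for K
            using that E_M K_M by (intro f_l) auto
          show "pairwise (\<lambda>K L. negligible (E n \<inter> K \<inter> (E n \<inter> L))) D"
            using D(3) by (rule pairwise_mono) (auto intro: negligible_subset)
        qed
        also have "\<dots> = measure M (E n \<inter> \<Union>D)"
        proof -
          have "E n \<inter> \<Union>D \<in> sets M" using E_M R_M by auto
          moreover have "(\<Union>K\<in>D. E n \<inter> K) = E n \<inter> \<Union>D" by auto
          ultimately show ?thesis by (simp add: meas_M sets_M)
        qed
        finally show ?thesis .
      qed
      moreover have "measure M (A - \<Union>D) \<le> \<epsilon>" "measure M (\<Union>D - A) \<le> \<epsilon>"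
        using D(4,5) A R_M by (auto simp: sets_M meas_M subset_iff)
      ultimately show ?thesis using R_M by blast
    qed
  qed (use E_M c \<phi> in \<open>auto simp: less_imp_le\<close>)
  then have "AE p in lborel. p \<in> X \<longrightarrow> infinite {n. p \<in> E n}"
    unfolding M_def by (subst (asm) AE_restrict_space_iff) auto
  then have "AE p in lborel \<Otimes>\<^sub>M lborel. p \<in> X \<longrightarrow> infinite {n. p \<in> E n}"
    by (simp only: lborel_prod)
  from lborel_pair.AE_pair[OF this] show ?thesis
  proof eventually_elim
    case (elim \<beta>)
    show ?case
    proof
      assume \<beta>: "\<beta> \<in> {a..b}"
      show "AE y in lborel. y \<in> {0..1} \<longrightarrow> infinite {n. \<bar>orb (Suc n) \<beta> - y\<bar> < \<phi> n}"
        using elim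
      proof eventually_elim
        case (elim y)
        have "{n. (\<beta>, y) \<in> E n} \<subseteq> {n. \<bar>orb (Suc n) \<beta> - y\<bar> < \<phi> n}"
          by (auto simp: E_def near_def)
        then show ?case using elim \<beta> finite_subset by (fastforce simp: X_def)
      qed
    qed
  qed
qed

lemma AE_approximates_AE:
  assumes \<phi>: "\<And>n. 0 < \<phi> n" "\<And>n. \<phi> n \<le> 1" "\<not> summable \<phi>"
  shows "AE \<beta> in lborel. 1 < \<beta> \<longrightarrow>
    (AE y in lborel. y \<in> {0..1} \<longrightarrow> infinite {n. \<bar>orb (Suc n) \<beta> - y\<bar> < \<phi> n})"
proof -
  have "AE \<beta> in lborel. \<forall>k::nat. \<beta> \<in> {1 + 1 / Suc k..2 + k} \<longrightarrow>
    (AE y in lborel. y \<in> {0..1} \<longrightarrow> infinite {n. \<bar>orb (Suc n) \<beta> - y\<bar> < \<phi> n})"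
    unfolding AE_all_countable
  proof
    fix k :: nat
    show "AE \<beta> in lborel. \<beta> \<in> {1 + 1 / Suc k..2 + k} \<longrightarrow>
      (AE y in lborel. y \<in> {0..1} \<longrightarrow> infinite {n. \<bar>orb (Suc n) \<beta> - y\<bar> < \<phi> n})"
      by (rule AE_near_infinitely_often) (use \<phi> in \<open>auto simp: field_simps\<close>)
  qed
  then show ?thesis
  proof eventually_elim
    case (elim \<beta>)
    show ?case
    proof
      assume "1 < \<beta>"
      obtain k1 where k1: "inverse (real (Suc k1)) < \<beta> - 1" using reals_Archimedean[of "\<beta> - 1"] \<open>1 < \<beta>\<close> by auto
      obtain k2 where k2: "\<beta> < real k2" using reals_Archimedean2 by blast
      define k where "k = max k1 k2"
      have "1 / Suc k \<le> 1 / Suc k1" by (intro frac_le) (auto simp: k_def)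
      then have "1 + 1 / Suc k \<le> \<beta>" using k1 by (simp add: inverse_eq_divide)
      moreover have "\<beta> \<le> 2 + k" using k2 by (simp add: k_def)
      ultimately show "AE y in lborel. y \<in> {0..1} \<longrightarrow> infinite {n. \<bar>orb (Suc n) \<beta> - y\<bar> < \<phi> n}"
        using elim by (auto simp: atLeastAtMost_iff)
    qed
  qed
qed

end

lemma approximable_set_eq:
  "approximable_set b x \<phi> =
     {y \<in> {0..1}. infinite {n. \<bar>(beta_transformation b ^^ Suc n) x - y\<bar> < \<phi> (Suc n)}}"
proof -
  have "{n. 1 \<le> n \<and> \<bar>(beta_transformation b ^^ n) x - y\<bar> < \<phi> n} =
      Suc ` {n. \<bar>(beta_transformation b ^^ Suc n) x - y\<bar> < \<phi> (Suc n)}" for y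
    by (auto simp: image_iff Suc_le_eq gr0_conv_Suc simp del: funpow.simps)
  then show ?thesis
    by (simp add: approximable_set_def finite_image_iff del: funpow.simps)
qed

lemma approximable_set_borel: "approximable_set b x \<phi> \<in> sets borel"
proof -
  have "{y \<in> space borel. y \<in> {0..1} \<and>
      (\<forall>m. \<exists>n\<ge>m. \<bar>(beta_transformation b ^^ Suc n) x - y\<bar> < \<phi> (Suc n))} \<in> sets borel"
    by measurable
  then show ?thesis
    unfolding approximable_set_eq infinite_nat_iff_unbounded_le by simp
qed

text \<open>
  This is the easy half of the Borel--Cantelli lemma, applied in the variable \<open>y\<close> to intervals of length \<open>2 * \<phi> (Suc n)\<close>; it holds
  for every \<open>b\<close>.
\<close>
lemma approximable_set_null:
  assumes "\<And>n. 0 < \<phi> (Suc n)" "summable (\<lambda>n. \<phi> (Suc n))"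
  shows "approximable_set b x \<phi> \<in> null_sets lborel"
proof -
  define z where "z = (\<lambda>n. (beta_transformation b ^^ Suc n) x)"
  let ?A = "\<lambda>n. {z n - \<phi> (Suc n)<..<z n + \<phi> (Suc n)}"
  have m: "measure lborel (?A n) = 2 * \<phi> (Suc n)" for n
    using assms(1)[of n] by simp
  have "AE y in lborel. eventually (\<lambda>n. y \<in> space lborel - ?A n) sequentially"
  proof (rule borel_cantelli_AE1)
    show "summable (\<lambda>n. measure lborel (?A n))"
      unfolding m using assms(2) by (rule summable_mult)
    show "emeasure lborel (?A n) < \<infinity>" for n
      using assms(1)[of n] by simp
  qed auto
  then have "AE y in lborel. y \<notin> approximable_set b x \<phi>"
  proof eventually_elim
    case (elim y)
    then obtain N where N: "\<And>n. N \<le> n \<Longrightarrow> y \<notin> ?A n"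
      by (auto simp: eventually_sequentially)
    have "{n. \<bar>(beta_transformation b ^^ Suc n) x - y\<bar> < \<phi> (Suc n)} \<subseteq> {..<N}"
    proof
      fix n assume "n \<in> {n. \<bar>(beta_transformation b ^^ Suc n) x - y\<bar> < \<phi> (Suc n)}"
      then have "y \<in> ?A n" by (auto simp: z_def)
      then show "n \<in> {..<N}" using N[of n] by (cases "N \<le> n") auto
    qed
    then show ?case
      unfolding approximable_set_eq using finite_subset by blast
  qed
  then show ?thesis
    using approximable_set_borel by (subst AE_iff_null_sets) auto
qed

theorem corollary1p3:
  fixes x :: real and \<phi> :: "nat \<Rightarrow> real"
  assumes "x \<in> {0<..1}"
    and "\<And>n. n \<ge> 1 \<Longrightarrow> \<phi> n \<in> {0<..1}"
  shows "AE b in lebesgue. b > 1 \<longrightarrow>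
           (summable (\<lambda>n. \<phi> (Suc n)) \<longrightarrow> approximable_set b x \<phi> \<in> null_sets lebesgue) \<and>
           (\<not> summable (\<lambda>n. \<phi> (Suc n)) \<longrightarrow> emeasure lebesgue (approximable_set b x \<phi>) = 1)"
proof (cases "summable (\<lambda>n. \<phi> (Suc n))")
  case True
  have "approximable_set b x \<phi> \<in> null_sets lebesgue" for b
    using approximable_set_null[of \<phi> b x] True assms(2) by (intro null_sets_completionI) auto
  then show ?thesis using True by simp
next
  case False
  interpret beta_orbit x by unfold_locales (use assms in auto)
  have "AE b in lborel. 1 < b \<longrightarrow>
      (AE y in lborel. y \<in> {0..1} \<longrightarrow> infinite {n. \<bar>orb (Suc n) b - y\<bar> < \<phi> (Suc n)})"
    using assms(2) False by (intro AE_approximates_AE) auto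
  then have "AE b in lborel. 1 < b \<longrightarrow> emeasure lebesgue (approximable_set b x \<phi>) = 1"
  proof eventually_elim
    case (elim b)
    show ?case
    proof
      assume "1 < b"
      then have "AE y in lborel. y \<in> approximable_set b x \<phi> \<longleftrightarrow> y \<in> {0..1}"
        using elim by (auto simp: approximable_set_eq orb_def)
      then have "emeasure lborel (approximable_set b x \<phi>) = emeasure lborel {0..1::real}"
        using approximable_set_borel by (intro emeasure_eq_AE) auto
      then show "emeasure lebesgue (approximable_set b x \<phi>) = 1"
        using approximable_set_borel by simp
    qed
  qed
  then have "AE b in lebesgue. 1 < b \<longrightarrow> emeasure lebesgue (approximable_set b x \<phi>) = 1"
    by (rule AE_completion)
  then show ?thesis using False by (auto elim: eventually_mono)
qed

end
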